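(* Let $(K,\Psi)$ be a standard Borel space, $k\ge1$, and let $\mu$ be a strongly stationary probability measure on $(K^{[k]^\ast},\Psi^{\otimes[k]^\ast})$. Then for any $A_1,\dots,A_k\in\Psi$, \[\mu^{\mathrm{line}}(A_1\times A_2\times\cdots\times A_k)=0\ \Longrightarrow\ \mu^{\mathrm{pt}}(A_1\cap A_2\cap\cdots\cap A_k)=0.\]
   Context: $[k]^\ast=\bigcup_{N\ge1}[k]^N$. For $n\ge1$, an $n$-dimensional subspace is an injection $\phi:[k]^n\hookrightarrow[k]^\ast$ specified by integers $0=N_0<N_1<\dots<N_n$, nonempty sets $I_i\subseteq[N_i]\setminus[N_{i-1}]$ and a word $w\in[k]^{N_n}$, via $\phi(v_1\cdots v_n)_m=w_m$ for $m\notin I_1\cup\dots\cup I_n$ and $=v_i$ for $m\in I_i$. An infinite-dimensional subspace $\phi:[k]^\ast\hookrightarrow[k]^\ast$ is specified by an infinite sequence $0=N_0<N_1<\cdots$, nonempty $I_{i+1}\subseteq[N_{i+1}]\setminus[N_i]$ and words $w_i\in[k]^{N_i}$, where for $v\in[k]^n$, $\phi(v)\in[k]^{N_n}$ is given by the same formula with $w=w_n$. For such $\phi$ (finite or infinite dimensional, with domain $D$) define $T_\phi:K^{[k]^\ast}\to K^{D}$ by $(T_\phi\mathbf x)_u=x_{\phi(u)}$. A probability $\mu$ on $K^{[k]^\ast}$ is strongly stationary if $(T_\phi)_\#\mu=\mu$ for every infinite-dimensional subspace $\phi$. For such $\mu$, $(T_\phi)_\#\mu$ is the same for all $N$-dimensional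 subspaces $\phi$ and for all choices of a single word ($N=0$, i.e. the law of one coordinate $x_w$); the point marginal $\mu^{\mathrm{pt}}$ is the law on $K$ of any single coordinate $x_w$, and the line marginal $\mu^{\mathrm{line}}$ is the law on $K^k$ of $(x_{\phi(1)},\dots,x_{\phi(k)})$ for any combinatorial line ($1$-dimensional subspace) $\phi$. *)

theory Defs
  imports "HOL-Probability.Probability"
begin

text \<open>Alphabet [k] = {1..k}; words are nat lists. Positions in words are 1-based
  in the formulas below (position m of word w is w ! (m - 1)).\<close>

definition words :: "nat \<Rightarrow> nat \<Rightarrow> nat list set" where
  "words k n = {v. length v = n \<and> set v \<subseteq> {1..k}}"

definition allwords :: "nat \<Rightarrow> nat list set" where
  "allwords k = {v. v \<noteq> [] \<and> set v \<subseteq> {1..k}}"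

definition sub_word :: "(nat \<Rightarrow> nat) \<Rightarrow> (nat \<Rightarrow> nat set) \<Rightarrow> nat list \<Rightarrow> nat list \<Rightarrow> nat list" where
  "sub_word N I w v =
     map (\<lambda>m. if \<exists>i\<in>{1..length v}. m \<in> I i
               then v ! ((THE i. i \<in> {1..length v} \<and> m \<in> I i) - 1)
               else w ! (m - 1))
         [1..<N (length v) + 1]"

text \<open>Data (N, I, w) of an n-dimensional subspace; the map is v \<mapsto> sub_word N I w v on words k n.\<close>
definition finite_subspace :: "nat \<Rightarrow> nat \<Rightarrow> (nat \<Rightarrow> nat) \<Rightarrow> (nat \<Rightarrow> nat set) \<Rightarrow> nat list \<Rightarrow> bool" where
  "finite_subspace k n N I w \<longleftrightarrow>
     n \<ge> 1 \<and> N 0 = 0 \<and> (\<forall>i<n. N i < N (Suc i)) \<and>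
     (\<forall>i<n. I (Suc i) \<noteq> {} \<and> I (Suc i) \<subseteq> {N i<..N (Suc i)}) \<and>
     w \<in> words k (N n)"

text \<open>Data (N, I, W) of an infinite-dimensional subspace; the map is
  v \<mapsto> sub_word N I (W (length v)) v on allwords k.\<close>
definition inf_subspace :: "nat \<Rightarrow> (nat \<Rightarrow> nat) \<Rightarrow> (nat \<Rightarrow> nat set) \<Rightarrow> (nat \<Rightarrow> nat list) \<Rightarrow> bool" where
  "inf_subspace k N I W \<longleftrightarrow>
     N 0 = 0 \<and> strict_mono N \<and>
     (\<forall>i. I (Suc i) \<noteq> {} \<and> I (Suc i) \<subseteq> {N i<..N (Suc i)}) \<and>
     (\<forall>n. W n \<in> words k (N n))"

definition config_space :: "nat \<Rightarrow> (nat list \<Rightarrow> 'a::topological_space) measure" where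
  "config_space k = PiM (allwords k) (\<lambda>_. borel)"

definition strongly_stationary :: "nat \<Rightarrow> (nat list \<Rightarrow> 'a::topological_space) measure \<Rightarrow> bool" where
  "strongly_stationary k \<mu> \<longleftrightarrow>
     (\<forall>N I W. inf_subspace k N I W \<longrightarrow>
        distr \<mu> (config_space k) (\<lambda>x. \<lambda>u\<in>allwords k. x (sub_word N I (W (length u)) u)) = \<mu>)"

definition mu_pt :: "(nat list \<Rightarrow> 'a::topological_space) measure \<Rightarrow> nat list \<Rightarrow> 'a measure" where
  "mu_pt \<mu> u = distr \<mu> borel (\<lambda>x. x u)"

definition mu_line :: "nat \<Rightarrow> (nat list \<Rightarrow> 'a::topological_space) measure \<Rightarrow>
    (nat \<Rightarrow> nat) \<Rightarrow> (nat \<Rightarrow> nat set) \<Rightarrow> nat list \<Rightarrow> (nat \<Rightarrow> 'a) measure" where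
  "mu_line k \<mu> N I w = distr \<mu> (PiM {1..k} (\<lambda>_. borel)) (\<lambda>x. \<lambda>j\<in>{1..k}. x (sub_word N I w [j]))"

end

theory Submission
  imports Defs
begin

text \<open>
By stationarity every word has the law of a single letter and every line the law of the line
\<^term>\<open>\<lambda>j. [j]\<close>. If the point marginal charged the intersection \<open>B\<close> of the \<open>A j\<close>, then the random
set of words of a fixed large length whose coordinate lies in \<open>B\<close> would have density bounded below
with positive probability, hence contain a line by the density Hales-Jewett theorem. There are
finitely many lines, so one of them, and then every line, would lie in \<open>B\<close> with positive probability.

The density Hales-Jewett theorem is proved by induction on the alphabet, for all product measures of
full support. Let \<open>a\<close> be the limiting maximal density of line-free sets over \<open>insert q S\<close>, and suppose
\<open>a > 0\<close>. In a line-free \<open>A\<close> of almost maximal density all sections over the words \<open>t\<close> of a fixed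
short length have density almost \<open>a\<close>. The theorem for \<open>S\<close> then yields a product measure for which the
words \<open>t\<close> such that replacing \<open>q\<close> by any letter of \<open>S\<close> leads into the section of \<open>A\<close> have measure
bounded below. Such \<open>t\<close> are not in the section themselves, so \<open>A\<close> is denser on the complement. That
complement is a disjoint union of intersections of sets each insensitive to exchanging \<open>q\<close> with one
letter, and these can almost be tiled by large subspaces, on one of which the density exceeds \<open>a\<close>.
\<close>

section \<open>Expectations over random words\<close>

definition wordset :: "'a set \<Rightarrow> nat \<Rightarrow> 'a list set" where
  "wordset S n = {w. length w = n \<and> set w \<subseteq> S}"

text \<open>Expectation over words of independent letters of law \<open>p\<close>. Peeling off the
  first letter makes Fubini, change of variables and monotonicity plain inductions on the
  length.\<close>

primrec wexp :: "'a set \<Rightarrow> ('a \<Rightarrow> real) \<Rightarrow> nat \<Rightarrow> ('a list \<Rightarrow> real) \<Rightarrow> real" where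
  "wexp S p 0 f = f []"
| "wexp S p (Suc n) f = (\<Sum>c\<in>S. p c * wexp S p n (\<lambda>w. f (c # w)))"

definition weights :: "'a set \<Rightarrow> ('a \<Rightarrow> real) \<Rightarrow> bool" where
  "weights S p \<longleftrightarrow> finite S \<and> (\<forall>c\<in>S. 0 < p c) \<and> sum p S = 1"

lemma wordset_0 [simp]: "wordset S 0 = {[]}"
  by (auto simp: wordset_def)

lemma Nil_in_wordset [simp]: "[] \<in> wordset S n \<longleftrightarrow> n = 0"
  by (auto simp: wordset_def)

lemma Cons_in_wordset [simp]: "c # w \<in> wordset S (Suc n) \<longleftrightarrow> c \<in> S \<and> w \<in> wordset S n"
  by (auto simp: wordset_def)

lemma append_in_wordset: "x \<in> wordset S m \<Longrightarrow> y \<in> wordset S n \<Longrightarrow> x @ y \<in> wordset S (m + n)"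
  by (auto simp: wordset_def)

lemma map_in_wordset: "w \<in> wordset S n \<Longrightarrow> (\<And>c. c \<in> S \<Longrightarrow> f c \<in> T) \<Longrightarrow> map f w \<in> wordset T n"
  by (auto simp: wordset_def)

lemma finite_wordset: "finite S \<Longrightarrow> finite (wordset S n)"
  using finite_lists_length_eq[of S n] by (simp add: wordset_def conj_commute)

lemma wordset_mono: "S \<subseteq> T \<Longrightarrow> wordset S n \<subseteq> wordset T n"
  by (auto simp: wordset_def)

lemma wordset_Suc: "wordset S (Suc n) = (\<lambda>(c, w). c # w) ` (S \<times> wordset S n)"
  by (auto simp: wordset_def length_Suc_conv image_iff)

lemma wexp_cong:
  "(\<And>w. w \<in> wordset S n \<Longrightarrow> f w = g w) \<Longrightarrow> wexp S p n f = wexp S p n g"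
proof (induction n arbitrary: f g)
  case (Suc n)
  have "wexp S p n (\<lambda>w. f (c # w)) = wexp S p n (\<lambda>w. g (c # w))" if "c \<in> S" for c
    using that by (intro Suc.IH) (simp add: Suc.prems)
  then show ?case by simp
qed simp

lemma wexp_eq_sum:
  assumes "finite S"
  shows "wexp S p n f = (\<Sum>w\<in>wordset S n. prod_list (map p w) * f w)"
proof (induction n arbitrary: f)
  case (Suc n)
  have "(\<Sum>w\<in>wordset S (Suc n). prod_list (map p w) * f w)
      = (\<Sum>(c, w)\<in>S \<times> wordset S n. p c * (prod_list (map p w) * f (c # w)))"
    unfolding wordset_Suc
    by (subst sum.reindex) (auto simp: inj_on_def case_prod_beta mult.assoc intro!: sum.cong)
  also have "\<dots> = (\<Sum>c\<in>S. p c * (\<Sum>w\<in>wordset S n. prod_list (map p w) * f (c # w)))"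
    by (simp add: sum.cartesian_product[symmetric] sum_distrib_left)
  finally show ?case by (simp add: Suc.IH)
qed simp

lemma wexp_add: "wexp S p n (\<lambda>w. f w + g w) = wexp S p n f + wexp S p n g"
  by (induction n arbitrary: f g) (simp_all add: distrib_left sum.distrib)

lemma wexp_cmult: "wexp S p n (\<lambda>w. c * f w) = c * wexp S p n f"
  by (induction n arbitrary: f) (simp_all add: sum_distrib_left mult.left_commute)

lemma wexp_diff: "wexp S p n (\<lambda>w. f w - g w) = wexp S p n f - wexp S p n g"
  by (induction n arbitrary: f g) (simp_all add: right_diff_distrib sum_subtractf)

lemma wexp_zero [simp]: "wexp S p n (\<lambda>w. 0) = 0"
  by (induction n) simp_all

lemma wexp_sum: "wexp S p n (\<lambda>w. \<Sum>i\<in>X. f i w) = (\<Sum>i\<in>X. wexp S p n (f i))"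
  by (induction X rule: infinite_finite_induct) (simp_all add: wexp_add)

lemma wexp_append:
  "wexp S p (m + n) f = wexp S p m (\<lambda>x. wexp S p n (\<lambda>y. f (x @ y)))"
  by (induction m arbitrary: f) simp_all

lemma wexp_swap:
  "wexp S p m (\<lambda>x. wexp T q n (\<lambda>y. f x y)) = wexp T q n (\<lambda>y. wexp S p m (\<lambda>x. f x y))"
  by (induction m arbitrary: f) (simp_all add: wexp_sum wexp_cmult)

text \<open>Applied letter by letter, \<open>f\<close> keeps the letters independent, so the image
  of a product measure is the product measure of the image law \<open>q\<close>.\<close>

lemma wexp_map:
  assumes "finite S" "finite T" "\<And>s. s \<in> S \<Longrightarrow> f s \<in> T"
    and "\<And>c. c \<in> T \<Longrightarrow> q c = (\<Sum>s\<in>{s\<in>S. f s = c}. p s)"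
  shows "wexp S p n (\<lambda>w. F (map f w)) = wexp T q n F"
proof (induction n arbitrary: F)
  case (Suc n)
  have "wexp S p (Suc n) (\<lambda>w. F (map f w)) = (\<Sum>s\<in>S. p s * wexp T q n (\<lambda>w. F (f s # w)))"
    using Suc.IH[of "\<lambda>w. F (f _ # w)"] by simp
  also have "\<dots> = (\<Sum>c\<in>T. \<Sum>s\<in>{s\<in>S. f s = c}. p s * wexp T q n (\<lambda>w. F (f s # w)))"
    using assms by (intro sum.group[symmetric]) auto
  also have "\<dots> = (\<Sum>c\<in>T. q c * wexp T q n (\<lambda>w. F (c # w)))"
    by (intro sum.cong) (auto simp: assms(4) sum_distrib_right)
  finally show ?case by simp
qed simp

section \<open>Averaging arguments for laws of full support\<close>

lemma weights_finite: "weights S p \<Longrightarrow> finite S"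
  and weights_pos: "weights S p \<Longrightarrow> c \<in> S \<Longrightarrow> 0 < p c"
  and weights_sum: "weights S p \<Longrightarrow> sum p S = 1"
  by (auto simp: weights_def)

lemma wexp_const [simp]: "weights S p \<Longrightarrow> wexp S p n (\<lambda>w. c) = c"
  by (induction n) (simp_all add: weights_sum flip: sum_distrib_right)

lemma wexp_mono:
  assumes "weights S p"
  shows "(\<And>w. w \<in> wordset S n \<Longrightarrow> f w \<le> g w) \<Longrightarrow> wexp S p n f \<le> wexp S p n g"
proof (induction n arbitrary: f g)
  case (Suc n)
  have "p c * wexp S p n (\<lambda>w. f (c # w)) \<le> p c * wexp S p n (\<lambda>w. g (c # w))" if "c \<in> S" for c
    using that weights_pos[OF assms that] by (intro mult_left_mono Suc.IH) (auto simp: Suc.prems)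
  then show ?case by (simp add: sum_mono)
qed simp

lemma wexp_le_const:
  "weights S p \<Longrightarrow> (\<And>w. w \<in> wordset S n \<Longrightarrow> f w \<le> c) \<Longrightarrow> wexp S p n f \<le> c"
  using wexp_mono[of S p n f "\<lambda>_. c"] by simp

lemma wexp_ge_const:
  "weights S p \<Longrightarrow> (\<And>w. w \<in> wordset S n \<Longrightarrow> c \<le> f w) \<Longrightarrow> c \<le> wexp S p n f"
  using wexp_mono[of S p n "\<lambda>_. c" f] by simp

lemma prod_list_weights_pos: "weights S p \<Longrightarrow> w \<in> wordset S n \<Longrightarrow> 0 < prod_list (map p w)"
  by (induction w arbitrary: n) (auto simp: wordset_def weights_pos)

lemma wexp_point:
  assumes "weights S p" "t \<in> wordset S n"
  shows "wexp S p n (\<lambda>w. of_bool (w = t)) = prod_list (map p t)"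
  using assms by (simp add: wexp_eq_sum weights_finite finite_wordset)

lemma min_word_weight:
  assumes "weights S p"
  obtains \<kappa> where "0 < \<kappa>" "\<And>w. w \<in> wordset S n \<Longrightarrow> \<kappa> \<le> prod_list (map p w)"
proof -
  let ?X = "insert 1 ((\<lambda>w. prod_list (map p w)) ` wordset S n)"
  have fin: "finite ?X"
    using assms by (simp add: finite_wordset weights_finite)
  have "0 < Min ?X"
    using fin prod_list_weights_pos[OF assms] by (subst Min_gr_iff) auto
  then show ?thesis
    using fin by (intro that[of "Min ?X"]) auto
qed

text \<open>Reverse Markov inequality: since \<open>f\<close> is at most 1, pointwise
  \<open>f w \<le> \<delta> + of_bool (\<delta> \<le> f w)\<close>.\<close>

lemma wexp_markov:
  assumes "weights S p" "\<And>w. w \<in> wordset S n \<Longrightarrow> f w \<le> 1" "\<delta> + \<delta>' \<le> wexp S p n f" "0 \<le> \<delta>"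
  shows "\<delta>' \<le> wexp S p n (\<lambda>w. of_bool (\<delta> \<le> f w))"
proof -
  have "wexp S p n f \<le> wexp S p n (\<lambda>w. \<delta> + of_bool (\<delta> \<le> f w))"
    using assms by (intro wexp_mono) (auto simp: of_bool_def intro: add_increasing)
  then show ?thesis
    using assms by (simp add: wexp_add)
qed

lemma wexp_pigeonhole:
  assumes w: "weights S p" and "finite X" "0 < \<delta>" "\<delta> \<le> wexp S p n f"
    and "\<And>w. w \<in> wordset S n \<Longrightarrow> f w \<le> (\<Sum>i\<in>X. h i w)"
  obtains i where "i \<in> X" "\<delta> / card X \<le> wexp S p n (h i)"
proof -
  have le: "\<delta> \<le> (\<Sum>i\<in>X. wexp S p n (h i))"
    using wexp_mono[OF w, of n f "\<lambda>w. \<Sum>i\<in>X. h i w"] assms by (simp add: wexp_sum)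
  then have "X \<noteq> {}" using \<open>0 < \<delta>\<close> by auto
  have "\<exists>i\<in>X. \<delta> / card X \<le> wexp S p n (h i)"
  proof (rule ccontr)
    assume "\<not> ?thesis"
    then have "(\<Sum>i\<in>X. wexp S p n (h i)) < (\<Sum>i\<in>X. \<delta> / card X)"
      using \<open>finite X\<close> \<open>X \<noteq> {}\<close> by (intro sum_strict_mono) auto
    then show False
      using le \<open>finite X\<close> \<open>X \<noteq> {}\<close> by simp
  qed
  then show ?thesis using that by blast
qed

section \<open>Combinatorial subspaces\<close>

text \<open>A subspace is encoded by a word over the letters \<^term>\<open>Inl c\<close> (constants) and the wildcards
  \<^term>\<open>Inr i\<close>, each of which has to occur. Unlike in \<^const>\<open>finite_subspace\<close>, the wildcard
  sets need not be ordered.\<close>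

primrec letter :: "'a list \<Rightarrow> 'a + nat \<Rightarrow> 'a" where
  "letter v (Inl c) = c"
| "letter v (Inr i) = v ! i"

definition sub :: "('a + nat) list \<Rightarrow> 'a list \<Rightarrow> 'a list" where
  "sub T v = map (letter v) T"

definition template :: "'a set \<Rightarrow> nat \<Rightarrow> nat \<Rightarrow> ('a + nat) list set" where
  "template S d n = {T \<in> wordset (S <+> {..<d}) n. Inr ` {..<d} \<subseteq> set T}"

lemma template_iff:
  "T \<in> template S d n \<longleftrightarrow> length T = n \<and> set T \<subseteq> S <+> {..<d} \<and> (\<forall>i<d. Inr i \<in> set T)"
  unfolding template_def wordset_def by (simp add: image_subset_iff Ball_def conj_assoc)

definition has_subspace :: "'a set \<Rightarrow> nat \<Rightarrow> nat \<Rightarrow> 'a list set \<Rightarrow> bool" where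
  "has_subspace S d n A \<longleftrightarrow> (\<exists>T\<in>template S d n. \<forall>v\<in>wordset S d. sub T v \<in> A)"

lemma sub_append: "sub (T @ U) v = sub T v @ sub U v"
  by (simp add: sub_def)

lemma sub_map_Inl [simp]: "sub (map Inl w) v = w"
  by (simp add: sub_def map_idI)

lemma letter_in: "s \<in> S <+> {..<d} \<Longrightarrow> v \<in> wordset S d \<Longrightarrow> letter v s \<in> S"
  by (auto simp: wordset_def)

lemma sub_in_wordset: "T \<in> template S d n \<Longrightarrow> v \<in> wordset S d \<Longrightarrow> sub T v \<in> wordset S n"
  unfolding template_def sub_def by (auto intro: map_in_wordset letter_in)

lemma finite_template: "finite S \<Longrightarrow> finite (template S d n)"
  unfolding template_def by (simp add: finite_wordset)

lemma template_mono: "S \<subseteq> S' \<Longrightarrow> template S d n \<subseteq> template S' d n"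
  unfolding template_def wordset_def by blast

lemma template_append_const:
  assumes "V \<in> template S d m" "a \<in> wordset S l" "y \<in> wordset S n"
  shows "map Inl a @ V @ map Inl y \<in> template S d (l + (m + n))"
  using assms unfolding template_def wordset_def by auto

section \<open>Composition and sections of subspaces\<close>

definition template_comp :: "('a + nat) list \<Rightarrow> ('a + nat) list \<Rightarrow> ('a + nat) list" where
  "template_comp T L = map (case_sum Inl (\<lambda>i. L ! i)) T"

lemma template_comp_in:
  assumes "T \<in> template S d n" "L \<in> template S e d"
  shows "template_comp T L \<in> template S e n"
proof -
  have T: "length T = n" "set T \<subseteq> S <+> {..<d}" "\<And>i. i < d \<Longrightarrow> Inr i \<in> set T"
    and L: "length L = d" "set L \<subseteq> S <+> {..<e}" "\<And>i. i < e \<Longrightarrow> Inr i \<in> set L"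
    using assms by (simp_all add: template_iff)
  have "case_sum Inl ((!) L) s \<in> S <+> {..<e}" if "s \<in> set T" for s
  proof (cases s)
    case (Inl c)
    then have "c \<in> S" using subsetD[OF T(2) that] by auto
    then show ?thesis using Inl by auto
  next
    case (Inr i)
    then have "i < d" using subsetD[OF T(2) that] by auto
    then have "L ! i \<in> set L" using L(1) by simp
    then show ?thesis using Inr L(2) by (simp add: subset_iff)
  qed
  moreover have "Inr i \<in> case_sum Inl ((!) L) ` set T" if i: "i < e" for i
  proof -
    obtain m where "m < d" "L ! m = Inr i"
      using L(3)[OF i] L(1) by (auto simp: in_set_conv_nth)
    then show ?thesis
      using T(3)[of m] by (intro image_eqI[of _ _ "Inr m"]) simp_all
  qed
  ultimately show ?thesis
    using T(1) by (simp add: template_iff template_comp_def image_subset_iff)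
qed

lemma sub_template_comp:
  assumes "T \<in> template S d n" "L \<in> template S e d"
  shows "sub (template_comp T L) v = sub T (sub L v)"
proof -
  have "letter v (case_sum Inl ((!) L) s) = letter (map (letter v) L) s" if "s \<in> set T" for s
    using that assms unfolding template_def wordset_def by (cases s) auto
  then show ?thesis
    by (simp add: sub_def template_comp_def)
qed

text \<open>In contrapositive form: the trace of a line-free set on a subspace is line-free, so
  density bounds for line-free sets apply on every subspace.\<close>

lemma has_subspace_pullback:
  assumes "T \<in> template S d n" "has_subspace S e d {v. sub T v \<in> A}"
  shows "has_subspace S e n A"
proof -
  obtain L where L: "L \<in> template S e d" "\<forall>v\<in>wordset S e. sub T (sub L v) \<in> A"
    using assms(2) by (auto simp: has_subspace_def)
  then show ?thesis
    using assms(1) unfolding has_subspace_def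
    by (intro bexI[of _ "template_comp T L"]) (auto simp: template_comp_in sub_template_comp)
qed

lemma id_template: "map Inr [0..<n] \<in> template S n n"
  by (auto simp: template_def wordset_def)

lemma sub_id_template: "length v = n \<Longrightarrow> sub (map Inr [0..<n]) v = v"
  by (auto simp: sub_def intro: nth_equalityI)

lemma has_subspace_cong:
  assumes "\<And>w. w \<in> wordset S n \<Longrightarrow> w \<in> A \<longleftrightarrow> w \<in> B"
  shows "has_subspace S d n A = has_subspace S d n B"
  unfolding has_subspace_def using assms by (meson sub_in_wordset)

lemma has_subspace_section_left:
  assumes "a \<in> wordset S l" "has_subspace S e n {y. a @ y \<in> A}"
  shows "has_subspace S e (l + n) A"
proof -
  let ?T = "map Inl a @ map Inr [0..<n]"
  have "?T \<in> template S n (l + n)"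
    using template_append_const[OF id_template assms(1), of "[]" 0] by simp
  moreover have "has_subspace S e n {v. sub ?T v \<in> A}"
    using assms(2) has_subspace_cong[of S n "{v. sub ?T v \<in> A}" "{y. a @ y \<in> A}" e]
    by (auto simp: sub_append sub_id_template wordset_def)
  ultimately show ?thesis by (rule has_subspace_pullback)
qed

lemma has_subspace_section_right:
  assumes "y \<in> wordset S l" "has_subspace S e n {x. x @ y \<in> A}"
  shows "has_subspace S e (n + l) A"
proof -
  let ?T = "map Inr [0..<n] @ map Inl y"
  have "?T \<in> template S n (n + l)"
    using template_append_const[OF id_template, of "[]" S 0 y l] assms(1) by simp
  moreover have "has_subspace S e n {v. sub ?T v \<in> A}"
    using assms(2) has_subspace_cong[of S n "{v. sub ?T v \<in> A}" "{x. x @ y \<in> A}" e]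
    by (auto simp: sub_append sub_id_template wordset_def)
  ultimately show ?thesis by (rule has_subspace_pullback)
qed

text \<open>All full-support product measures are considered because identifying letters turns the uniform
  measure into a non-uniform one.\<close>

definition dense_subspaces :: "'a set \<Rightarrow> nat \<Rightarrow> bool" where
  "dense_subspaces S d \<longleftrightarrow> (\<forall>p \<delta>. weights S p \<longrightarrow> 0 < \<delta> \<longrightarrow>
     (\<exists>n. \<forall>A. \<delta> \<le> wexp S p n (\<lambda>w. of_bool (w \<in> A)) \<longrightarrow> has_subspace S d n A))"

section \<open>From lines to subspaces of any dimension\<close>

lemma template_append_fresh:
  assumes T: "T \<in> template S d m" and L: "L \<in> template S 1 n"
  shows "T @ map (case_sum Inl (\<lambda>_. Inr d)) L \<in> template S (Suc d) (m + n)"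
proof -
  have T: "length T = m" "set T \<subseteq> S <+> {..<d}" "\<And>i. i < d \<Longrightarrow> Inr i \<in> set T"
    and L: "length L = n" "set L \<subseteq> S <+> {..<1}" "Inr 0 \<in> set L"
    using assms by (simp_all add: template_iff)
  have "case_sum Inl (\<lambda>_. Inr d) ` set L \<subseteq> S <+> {..<Suc d}"
    using L(2) by (auto simp: Plus_def)
  moreover have "set T \<subseteq> S <+> {..<Suc d}"
    using T(2) by (auto simp: Plus_def less_Suc_eq)
  moreover have "Inr d \<in> case_sum Inl (\<lambda>_. Inr d) ` set L"
    using L(3) by (intro image_eqI[of _ _ "Inr 0"]) simp_all
  ultimately show ?thesis
    using T(1,3) L(1) by (simp add: template_iff less_Suc_eq)
qed

lemma sub_append_fresh:
  assumes T: "T \<in> template S d m" and L: "L \<in> template S 1 n" and v: "v \<in> wordset S d"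
  shows "sub (T @ map (case_sum Inl (\<lambda>_. Inr d)) L) (v @ [c]) = sub T v @ sub L [c]"
proof -
  have "letter (v @ [c]) s = letter v s" if "s \<in> set T" for s
    using that T v by (cases s) (auto simp: template_iff wordset_def nth_append)
  moreover have "letter (v @ [c]) (case_sum Inl (\<lambda>_. Inr d) s) = letter [c] s" if "s \<in> set L" for s
    using that L v by (cases s) (auto simp: template_iff wordset_def)
  ultimately show ?thesis
    by (simp add: sub_def)
qed

text \<open>Split the word as \<open>x @ y\<close>. For a dense set of \<open>y\<close> the section
  in \<open>x\<close> contains a \<open>d\<close>-dimensional subspace; there are finitely many, so
  one \<open>T\<close> serves a dense set of \<open>y\<close>, which contains a line
  \<open>L\<close>. The product of \<open>T\<close> and \<open>L\<close> has dimension
  \<open>Suc d\<close>.\<close>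

lemma dense_subspaces_of_lines:
  assumes "dense_subspaces S 1"
  shows "dense_subspaces S d"
proof (induction d)
  case 0
  have "has_subspace S 0 0 A" if "0 < \<delta>" "\<delta> \<le> of_bool ([] \<in> A)" for \<delta> :: real and A
    using that by (cases "[] \<in> A") (auto simp: has_subspace_def template_def sub_def)
  then show ?case
    unfolding dense_subspaces_def by (intro allI impI exI[of _ 0]) simp
next
  case (Suc d)
  show ?case unfolding dense_subspaces_def
  proof (intro allI impI)
    fix p :: "'a \<Rightarrow> real" and \<delta> :: real
    assume w: "weights S p" and "0 < \<delta>"
    obtain n1 where n1: "\<And>A. \<delta>/2 \<le> wexp S p n1 (\<lambda>w. of_bool (w \<in> A)) \<Longrightarrow> has_subspace S d n1 A"
      using Suc w \<open>0 < \<delta>\<close> unfolding dense_subspaces_def by (meson half_gt_zero)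
    define M where "M = card (template S d n1)"
    \<comment> \<open>\<open>M + 1\<close> keeps the quotient positive before \<open>M > 0\<close>
      is known.\<close>
    have "0 < \<delta> / 2 / (M + 1)" using \<open>0 < \<delta>\<close> by simp
    then obtain n2 where n2: "\<And>A. \<delta> / 2 / (M + 1) \<le> wexp S p n2 (\<lambda>w. of_bool (w \<in> A)) \<Longrightarrow> has_subspace S 1 n2 A"
      using assms w unfolding dense_subspaces_def by meson
    have "has_subspace S (Suc d) (n1 + n2) A"
      if A: "\<delta> \<le> wexp S p (n1 + n2) (\<lambda>w. of_bool (w \<in> A))" for A
    proof -
      define f where "f y = wexp S p n1 (\<lambda>x. of_bool (x @ y \<in> A))" for y
      have "\<delta>/2 + \<delta>/2 \<le> wexp S p n2 f"
        using A by (simp add: wexp_append wexp_swap[of S p n1] f_def[abs_def])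
      note dens = this
      have f1: "f y \<le> 1" for y
        unfolding f_def by (intro wexp_le_const[OF w]) simp
      have markov: "\<delta>/2 \<le> wexp S p n2 (\<lambda>y. of_bool (\<delta>/2 \<le> f y))"
        using wexp_markov[OF w, of n2 f "\<delta>/2" "\<delta>/2"] f1 dens \<open>0 < \<delta>\<close> by simp
      define h where "h T y = (of_bool (\<forall>v\<in>wordset S d. sub T v @ y \<in> A) :: real)" for T y
      have cover: "of_bool (\<delta>/2 \<le> f y) \<le> (\<Sum>T\<in>template S d n1. h T y)" for y
      proof (cases "\<delta>/2 \<le> f y")
        case True
        then have "has_subspace S d n1 {x. x @ y \<in> A}"
          by (intro n1) (simp add: f_def)
        then obtain T where "T \<in> template S d n1" "h T y = 1"
          by (auto simp: has_subspace_def h_def)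
        then show ?thesis
          using member_le_sum[of T "template S d n1" "\<lambda>T. h T y"] finite_template[OF weights_finite[OF w]]
          by (simp add: h_def)
      qed (simp add: h_def sum_nonneg)
      obtain T where T: "T \<in> template S d n1" and "\<delta>/2 / M \<le> wexp S p n2 (h T)"
        unfolding M_def
        by (rule wexp_pigeonhole[OF w finite_template[OF weights_finite[OF w]] half_gt_zero[OF \<open>0 < \<delta>\<close>] markov cover])
      moreover have "M > 0"
        using T finite_template[OF weights_finite[OF w]] by (auto simp: M_def card_gt_0_iff)
      then have "\<delta>/2 / (M + 1) \<le> \<delta>/2 / M"
        using \<open>0 < \<delta>\<close> by (intro divide_left_mono) auto
      ultimately have "has_subspace S 1 n2 {y. \<forall>v\<in>wordset S d. sub T v @ y \<in> A}"
        by (intro n2) (simp add: h_def[abs_def])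
      then obtain L where L: "L \<in> template S 1 n2"
        "\<forall>z\<in>wordset S 1. \<forall>v\<in>wordset S d. sub T v @ sub L z \<in> A"
        by (auto simp: has_subspace_def)
      let ?U = "T @ map (case_sum Inl (\<lambda>_. Inr d)) L"
      have "sub ?U v \<in> A" if v: "v \<in> wordset S (Suc d)" for v
      proof -
        have "v = butlast v @ [last v]" "butlast v \<in> wordset S d" "[last v] \<in> wordset S 1"
          using v by (auto simp: wordset_def dest: in_set_butlastD) (metis append_butlast_last_id length_0_conv nat.distinct(1), metis last_in_set length_0_conv nat.distinct(1) subsetD)
        then show ?thesis
          using L(2) sub_append_fresh[OF T L(1), of "butlast v" "last v"] by metis
      qed
      then show ?thesis
        unfolding has_subspace_def using template_append_fresh[OF T L(1)] by blast
    qed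
    then show "\<exists>n. \<forall>A. \<delta> \<le> wexp S p n (\<lambda>w. of_bool (w \<in> A)) \<longrightarrow> has_subspace S (Suc d) n A"
      by blast
  qed
qed

section \<open>Change of measure through random subspaces\<close>

lemma template_Cons_const: "T \<in> template S d n \<Longrightarrow> c \<in> S \<Longrightarrow> Inl c # T \<in> template S d (Suc n)"
  by (auto simp: template_iff)

text \<open>The new wildcard gets number 0 and the old ones are shifted, to match
  \<open>wexp\<close>, which averages over the first letter first.\<close>

lemma template_Cons_fresh:
  assumes "T \<in> template S d n"
  shows "Inr 0 # map (map_sum id Suc) T \<in> template S (Suc d) (Suc n)"
proof -
  have T: "length T = n" "set T \<subseteq> S <+> {..<d}" "\<And>i. i < d \<Longrightarrow> Inr i \<in> set T"
    using assms by (simp_all add: template_iff)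
  have "map_sum id Suc ` set T \<subseteq> S <+> {..<Suc d}"
    using T(2) by (auto simp: Plus_def)
  moreover have "i = 0 \<or> Inr i \<in> map_sum id Suc ` set T" if "i < Suc d" for i
    using that T(3)[of "i - 1"] image_eqI[of "Inr i" "map_sum id Suc" "Inr (i - 1)" "set T"]
    by (cases i) simp_all
  ultimately show ?thesis
    using T(1) by (auto simp: template_iff)
qed

lemma sub_Cons_fresh: "sub (Inr 0 # map (map_sum id Suc) T) (c # v) = c # sub T v"
proof -
  have "letter (c # v) (map_sum id Suc s) = letter v s" for s
    by (cases s) simp_all
  then show ?thesis by (simp add: sub_def)
qed

text \<open>Write \<open>p\<close> as a mixture with a component \<open>l * p0\<close>, and condition on the positions drawn from
  that component: they span a subspace, of dimension less than \<open>d\<close> with probability at most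
  \<open>2 ^ d * (1 - l / 2) ^ n\<close>.\<close>

lemma wexp_transfer:
  assumes p: "weights S p" and p0: "weights S p0" and "0 \<le> l" "l \<le> 1" "\<And>c. c \<in> S \<Longrightarrow> l * p0 c \<le> p c"
    and "0 \<le> b"
  shows "(\<And>w. w \<in> wordset S n \<Longrightarrow> f w \<le> 1) \<Longrightarrow>
    (\<And>T. T \<in> template S d n \<Longrightarrow> wexp S p0 d (\<lambda>v. f (sub T v)) \<le> b) \<Longrightarrow>
    wexp S p n f \<le> b + 2 ^ d * (1 - l / 2) ^ n"
proof (induction n arbitrary: d f)
  case 0
  show ?case
  proof (cases d)
    case 0
    then show ?thesis
      using "0.prems"(2)[of "[]"] by (simp add: template_iff sub_def)
  next
    case (Suc d')
    have "(1::real) \<le> 2 ^ d" by simp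
    moreover have "f [] \<le> 1" using "0.prems"(1)[of "[]"] by simp
    ultimately have "f [] \<le> b + 2 ^ d" using \<open>0 \<le> b\<close> by linarith
    then show ?thesis by simp
  qed
next
  case (Suc n)
  note IH = Suc.IH and bound = Suc.prems(1) and subspaces = Suc.prems(2)
  show ?case
  proof (cases d)
    case 0
    have "wexp S p (Suc n) f \<le> b"
    proof (rule wexp_le_const[OF p])
      fix w assume "w \<in> wordset S (Suc n)"
      then have "map Inl w \<in> template S 0 (Suc n)"
        by (auto simp: template_iff wordset_def)
      from subspaces[unfolded 0, OF this] show "f w \<le> b" by simp
    qed
    moreover have "0 \<le> (1 - l / 2) ^ Suc n"
      using \<open>l \<le> 1\<close> by (intro zero_le_power) simp
    ultimately show ?thesis using 0 by simp
  next
    case (Suc e)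
    let ?r = "1 - l / 2"
    let ?g = "\<lambda>w. \<Sum>c\<in>S. p0 c * f (c # w)"
    \<comment> \<open>A first letter drawn from the remainder \<open>p - l * p0\<close> becomes a
      constant; dimension \<open>d\<close> is still to be found in the rest.\<close>
    have const: "wexp S p n (\<lambda>w. f (c # w)) \<le> b + 2 ^ d * ?r ^ n" if "c \<in> S" for c
    proof (rule IH)
      show "f (c # w) \<le> 1" if "w \<in> wordset S n" for w
        using that \<open>c \<in> S\<close> by (intro bound) simp
      show "wexp S p0 d (\<lambda>v. f (c # sub T v)) \<le> b" if "T \<in> template S d n" for T
        using subspaces[OF template_Cons_const[OF that \<open>c \<in> S\<close>]] by (simp add: sub_def)
    qed
    \<comment> \<open>A first letter drawn from \<open>l * p0\<close> becomes a wildcard, averaged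
      over \<open>p0\<close>; dimension \<open>e = d - 1\<close> remains.\<close>
    have free: "wexp S p n ?g \<le> b + 2 ^ e * ?r ^ n"
    proof (rule IH)
      show "?g w \<le> 1" if "w \<in> wordset S n" for w
      proof -
        have "?g w \<le> (\<Sum>c\<in>S. p0 c * 1)"
          using that weights_pos[OF p0] by (intro sum_mono mult_left_mono bound) (auto intro: less_imp_le)
        then show ?thesis by (simp add: weights_sum[OF p0])
      qed
      show "wexp S p0 e (\<lambda>v. ?g (sub T v)) \<le> b" if "T \<in> template S e n" for T
        using subspaces[unfolded Suc, OF template_Cons_fresh[OF that]]
        by (simp add: sub_Cons_fresh wexp_sum wexp_cmult)
    qed
    have "wexp S p (Suc n) f = l * wexp S p n ?g + (\<Sum>c\<in>S. (p c - l * p0 c) * wexp S p n (\<lambda>w. f (c # w)))"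
      by (simp add: wexp_sum wexp_cmult left_diff_distrib sum_subtractf sum_distrib_left mult.assoc)
    also have "\<dots> \<le> l * (b + 2 ^ e * ?r ^ n) + (\<Sum>c\<in>S. (p c - l * p0 c) * (b + 2 ^ d * ?r ^ n))"
      using free const assms(3,5) by (intro add_mono mult_left_mono sum_mono) auto
    also have "(\<Sum>c\<in>S. (p c - l * p0 c) * (b + 2 ^ d * ?r ^ n)) = (1 - l) * (b + 2 ^ d * ?r ^ n)"
      by (simp add: sum_subtractf weights_sum[OF p] weights_sum[OF p0] flip: sum_distrib_right sum_distrib_left)
    \<comment> \<open>As \<open>2 ^ d = 2 * 2 ^ e\<close>, one has
      \<open>l * 2 ^ e + (1 - l) * 2 ^ d = 2 ^ d * (1 - l / 2)\<close>, which dictates the rate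
      \<open>?r\<close>.\<close>
    also have "l * (b + 2 ^ e * ?r ^ n) + (1 - l) * (b + 2 ^ d * ?r ^ n) = b + 2 ^ d * ?r ^ Suc n"
      using Suc by (simp add: algebra_simps)
    finally show ?thesis .
  qed
qed

section \<open>Tiling insensitive sets by subspaces\<close>

text \<open>The quotient is the density, with respect to the product measure on words of length
  \<open>m\<close>, of the image measure of the subspace \<open>V\<close>.\<close>

lemma wexp_pushforward_density:
  assumes w: "weights S p" and V: "V \<in> template S d m"
  shows "wexp S p m (\<lambda>x. wexp S p d (\<lambda>v. of_bool (sub V v = x)) / prod_list (map p x) * h x)
       = wexp S p d (\<lambda>v. h (sub V v))"
proof -
  have fin: "finite (wordset S n)" for n
    using w by (simp add: finite_wordset weights_finite)
  have "wexp S p m (\<lambda>x. wexp S p d (\<lambda>v. of_bool (sub V v = x)) / prod_list (map p x) * h x)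
      = (\<Sum>x\<in>wordset S m. wexp S p d (\<lambda>v. of_bool (sub V v = x)) * h x)"
    unfolding wexp_eq_sum[OF weights_finite[OF w], of p m]
    using prod_list_weights_pos[OF w] by (intro sum.cong) (auto simp: less_imp_neq[THEN not_sym])
  also have "\<dots> = wexp S p d (\<lambda>v. \<Sum>x\<in>wordset S m. h x * of_bool (sub V v = x))"
    by (simp add: wexp_sum wexp_cmult mult.commute)
  also have "\<dots> = wexp S p d (\<lambda>v. h (sub V v))"
    using fin sub_in_wordset[OF V] by (intro wexp_cong) (simp add: of_bool_def if_distrib cong: if_cong)
  finally show ?thesis .
qed

lemma mult_le_right: "a \<le> 1 \<Longrightarrow> 0 \<le> b \<Longrightarrow> a * b \<le> b" for a b :: real
  by (simp add: mult_le_cancel_right2)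

lemma append_middle_in_wordset:
  "a \<in> wordset S l \<Longrightarrow> x \<in> wordset S m \<Longrightarrow> y \<in> wordset S n \<Longrightarrow> a @ x @ y \<in> wordset S (l + (m + n))"
  by (intro append_in_wordset)

lemma wexp_append_middle:
  "wexp S p (l + (m + n)) f =
   wexp S p l (\<lambda>a. wexp S p n (\<lambda>y. wexp S p m (\<lambda>x. f (a @ x @ y))))"
  by (simp add: wexp_append wexp_swap[of S p m])

text \<open>The weight \<open>e\<close> is tiled fractionally, block by block of length \<open>m\<close>. For every choice of the
  other letters for which the average of \<open>e\<close> over the current block is not small, a multiple of the
  image measure of a subspace on which \<open>e\<close> is at least \<open>\<epsilon>\<close> is subtracted. The remainder stays
  insensitive in the blocks not yet used (which is why the letters before position \<open>l\<close> are exempt),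
  and each step costs total mass \<open>\<kappa> * \<epsilon>\<close>, so at most \<open>s\<close> steps are needed.\<close>

lemma wexp_insensitive_le:
  fixes r :: "'a \<Rightarrow> 'a" and e g :: "'a list \<Rightarrow> real"
  assumes w: "weights S p"
    and r: "\<And>c. c \<in> S \<Longrightarrow> r c \<in> S" "\<And>c. c \<in> S \<Longrightarrow> r (r c) = r c"
    and "0 < \<epsilon>" "0 \<le> \<eta>" "0 < \<kappa>"
    and \<kappa>: "\<And>x. x \<in> wordset S m \<Longrightarrow> \<kappa> \<le> \<epsilon> * prod_list (map p x)"
    and dense: "\<And>E. (\<forall>x\<in>wordset S m. map r x \<in> E \<longleftrightarrow> x \<in> E) \<Longrightarrow>
        \<epsilon> \<le> wexp S p m (\<lambda>x. of_bool (x \<in> E)) \<Longrightarrow> has_subspace S d m E"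
  shows "(\<And>w. w \<in> wordset S (l + s * m) \<Longrightarrow> 0 \<le> e w \<and> e w \<le> 1) \<Longrightarrow>
    (\<And>a z. a \<in> wordset S l \<Longrightarrow> z \<in> wordset S (s * m) \<Longrightarrow> e (a @ map r z) = e (a @ z)) \<Longrightarrow>
    (\<And>w. w \<in> wordset S (l + s * m) \<Longrightarrow> g w \<le> 1) \<Longrightarrow>
    (\<And>V. V \<in> template S d (l + s * m) \<Longrightarrow> wexp S p d (\<lambda>v. g (sub V v)) \<le> \<eta>) \<Longrightarrow>
    wexp S p (l + s * m) e \<le> s * (\<kappa> * \<epsilon>) + 3 * \<epsilon> \<Longrightarrow>
    wexp S p (l + s * m) (\<lambda>w. g w * e w) \<le> \<eta> * wexp S p (l + s * m) e + 3 * \<epsilon>"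
proof (induction s arbitrary: l e)
  case 0
  have "wexp S p l (\<lambda>w. g w * e w) \<le> wexp S p l e"
  proof (rule wexp_mono[OF w])
    show "g x * e x \<le> e x" if "x \<in> wordset S l" for x
      using "0.prems"(1,3)[of x] that by (intro mult_le_right) simp_all
  qed
  moreover have "0 \<le> \<eta> * wexp S p l e"
    using "0.prems"(1) \<open>0 \<le> \<eta>\<close> by (intro mult_nonneg_nonneg wexp_ge_const[OF w]) auto
  ultimately show ?case
    using "0.prems"(5) by simp
next
  case (Suc s)
  \<comment> \<open>Words are split as \<open>a @ x @ y\<close>: \<open>l\<close> exempt letters,
    the current block of \<open>m\<close> letters, and \<open>n\<close> letters for the remaining
    \<open>s\<close> steps.\<close>
  define n where "n = s * m"
  have len: "l + Suc s * m = l + (m + n)" "(l + m) + s * m = l + (m + n)"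
    by (simp_all add: n_def)
  note e01 = Suc.prems(1)[unfolded len] and ins = Suc.prems(2)[folded n_def]
    and g1 = Suc.prems(3)[unfolded len] and subspaces = Suc.prems(4)[unfolded len]
    and mass = Suc.prems(5)[unfolded len]
  have mapr: "map r x \<in> wordset S i" "map r (map r x) = map r x" if "x \<in> wordset S i" for x i
    using that r by (auto simp: wordset_def intro: map_in_wordset)
  have ins_both: "e (a @ map r x @ map r y) = e (a @ x @ y)"
    if "a \<in> wordset S l" "x \<in> wordset S m" "y \<in> wordset S n" for a x y
    using ins[of a "x @ y"] append_in_wordset[OF that(2,3)] that(1) by (simp add: n_def)
  \<comment> \<open>As \<open>r\<close> is idempotent, replacing \<open>y\<close> by
    \<open>map r y\<close> does not change the fully collapsed word; so the two parts can be
    collapsed separately.\<close>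
  have ins_right: "e (a @ x @ map r y) = e (a @ x @ y)"
    if "a \<in> wordset S l" "x \<in> wordset S m" "y \<in> wordset S n" for a x y
    using ins_both[of a x y] ins_both[of a x "map r y"] that mapr by metis
  have ins_left: "e (a @ map r x @ y) = e (a @ x @ y)"
    if "a \<in> wordset S l" "x \<in> wordset S m" "y \<in> wordset S n" for a x y
    using ins_both[of a x y] ins_right[of a "map r x" y] that mapr by metis
  define f where "f a y = wexp S p m (\<lambda>x. e (a @ x @ y))" for a y
  define Q where "Q F = wexp S p l (\<lambda>a. wexp S p n (\<lambda>y. F a y))" for F :: "'a list \<Rightarrow> 'a list \<Rightarrow> real"
  have Q: "wexp S p (l + (m + n)) F = Q (\<lambda>a y. wexp S p m (\<lambda>x. F (a @ x @ y)))" for F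
    by (simp add: wexp_append_middle Q_def)
  have Q_mono: "Q F \<le> Q G" if "\<And>a y. a \<in> wordset S l \<Longrightarrow> y \<in> wordset S n \<Longrightarrow> F a y \<le> G a y" for F G
    unfolding Q_def using that by (intro wexp_mono[OF w]) auto
  have f1: "f a y \<le> 1" if "a \<in> wordset S l" "y \<in> wordset S n" for a y
    unfolding f_def using e01 append_middle_in_wordset that by (intro wexp_le_const[OF w]) blast
  define good where "good a y \<longleftrightarrow> 2 * \<epsilon> \<le> f a y" for a y
  define P where "P = Q (\<lambda>a y. of_bool (good a y))"
  show ?case
  proof (cases "P < \<epsilon>")
    case True
    \<comment> \<open>Good pairs are rare, so \<open>e\<close> has mass at most
      \<open>3 * \<epsilon>\<close> and the trivial bound \<open>g \<le> 1\<close> suffices.\<close>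
    have "wexp S p (l + (m + n)) e \<le> Q (\<lambda>a y. 2 * \<epsilon> + of_bool (good a y))"
      unfolding Q f_def[symmetric] using f1 \<open>0 < \<epsilon>\<close>
      by (intro Q_mono) (auto simp: good_def of_bool_def intro: add_increasing)
    also have "\<dots> = 2 * \<epsilon> + P"
      by (simp add: P_def Q_def wexp_add wexp_const[OF w])
    finally have small: "wexp S p (l + (m + n)) e \<le> 3 * \<epsilon>"
      using True by simp
    have "wexp S p (l + (m + n)) (\<lambda>w. g w * e w) \<le> wexp S p (l + (m + n)) e"
    proof (rule wexp_mono[OF w])
      show "g x * e x \<le> e x" if "x \<in> wordset S (l + (m + n))" for x
        using e01[OF that] g1[OF that] by (intro mult_le_right) simp_all
    qed
    moreover have "0 \<le> \<eta> * wexp S p (l + (m + n)) e"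
      using e01 \<open>0 \<le> \<eta>\<close> by (intro mult_nonneg_nonneg wexp_ge_const[OF w]) auto
    ultimately show ?thesis
      using small unfolding len by simp
  next
    case False
    define E where "E a y = {x \<in> wordset S m. \<epsilon> \<le> e (a @ x @ y)}" for a y
    \<comment> \<open>The choice depends on \<open>y\<close> only through \<open>E a y\<close>,
      hence is unchanged when \<open>y\<close> is collapsed; this keeps the remainder
      \<open>e'\<close> insensitive.\<close>
    define V where "V a y = (SOME V. V \<in> template S d m \<and> (\<forall>v\<in>wordset S d. sub V v \<in> E a y))" for a y
    have V: "V a y \<in> template S d m \<and> (\<forall>v\<in>wordset S d. sub (V a y) v \<in> E a y)"
      if a: "a \<in> wordset S l" and y: "y \<in> wordset S n" and "good a y" for a y
    proof -
      have "\<epsilon> \<le> wexp S p m (\<lambda>x. of_bool (\<epsilon> \<le> e (a @ x @ y)))"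
        using \<open>good a y\<close> \<open>0 < \<epsilon>\<close> e01 append_middle_in_wordset[OF a _ y]
        by (intro wexp_markov[OF w]) (auto simp: good_def f_def)
      also have "\<dots> = wexp S p m (\<lambda>x. of_bool (x \<in> E a y))"
        by (intro wexp_cong) (simp add: E_def)
      finally have big: "\<epsilon> \<le> wexp S p m (\<lambda>x. of_bool (x \<in> E a y))" .
      have "map r x \<in> E a y \<longleftrightarrow> x \<in> E a y" if "x \<in> wordset S m" for x
        unfolding E_def mem_Collect_eq ins_left[OF a that y] using that mapr(1)[OF that] by iprover
      then have "has_subspace S d m (E a y)"
        by (intro dense[OF _ big] ballI)
      then have "\<exists>V. V \<in> template S d m \<and> (\<forall>v\<in>wordset S d. sub V v \<in> E a y)"
        unfolding has_subspace_def by blast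
      then show ?thesis
        unfolding V_def by (rule someI_ex)
    qed
    \<comment> \<open>On good pairs this is \<open>\<kappa>\<close> times the density of the image
      measure of \<open>V a y\<close>. The hypothesis on \<open>\<kappa>\<close> makes it at most
      \<open>\<epsilon>\<close>, hence at most \<open>e\<close> on the tile.\<close>
    define u where "u a x y = of_bool (good a y) * \<kappa> *
      (wexp S p d (\<lambda>v. of_bool (sub (V a y) v = x)) / prod_list (map p x))" for a x y
    have u_nonneg: "0 \<le> u a x y" if "x \<in> wordset S m" for a x y
      using \<open>0 < \<kappa>\<close> prod_list_weights_pos[OF w that] unfolding u_def
      by (intro mult_nonneg_nonneg divide_nonneg_nonneg wexp_ge_const[OF w]) auto
    have u_le: "u a x y \<le> e (a @ x @ y)"
      if a: "a \<in> wordset S l" and x: "x \<in> wordset S m" and y: "y \<in> wordset S n" for a x y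
    proof (cases "good a y \<and> x \<in> E a y")
      case True
      have "wexp S p d (\<lambda>v. of_bool (sub (V a y) v = x)) \<le> 1"
        by (intro wexp_le_const[OF w]) simp
      then have "\<kappa> * (wexp S p d (\<lambda>v. of_bool (sub (V a y) v = x)) / prod_list (map p x))
          \<le> \<kappa> * (1 / prod_list (map p x))"
        using \<open>0 < \<kappa>\<close> prod_list_weights_pos[OF w x]
        by (intro mult_left_mono divide_right_mono) simp_all
      then have "u a x y \<le> \<kappa> * (1 / prod_list (map p x))"
        using True by (simp add: u_def)
      also have "\<dots> \<le> \<epsilon>"
        using \<kappa>[OF x] prod_list_weights_pos[OF w x] by (simp add: divide_le_eq)
      also have "\<dots> \<le> e (a @ x @ y)"
        using True by (simp add: E_def)
      finally show ?thesis .
    next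
      case False
      have "u a x y = 0"
      proof (cases "good a y")
        case True
        then have "wexp S p d (\<lambda>v. of_bool (sub (V a y) v = x)) = wexp S p d (\<lambda>v. 0)"
          using False V[OF a y] by (intro wexp_cong) auto
        then show ?thesis by (simp add: u_def)
      qed (simp add: u_def)
      then show ?thesis
        using e01[OF append_middle_in_wordset[OF a x y]] by simp
    qed
    have u_exp: "wexp S p m (\<lambda>x. h x * u a x y) = of_bool (good a y) * \<kappa> * wexp S p d (\<lambda>v. h (sub (V a y) v))"
      if "a \<in> wordset S l" "y \<in> wordset S n" for a y h
    proof (cases "good a y")
      case True
      have "wexp S p m (\<lambda>x. h x * u a x y) = wexp S p m (\<lambda>x. \<kappa> *
          (wexp S p d (\<lambda>v. of_bool (sub (V a y) v = x)) / prod_list (map p x) * h x))"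
        using True by (intro wexp_cong) (simp add: u_def mult_ac)
      then show ?thesis
        unfolding wexp_cmult wexp_pushforward_density[OF w conjunct1[OF V[OF that True]]]
        using True by simp
    qed (simp add: u_def)
    define e' where "e' z = e z - u (take l z) (take m (drop l z)) (drop (l + m) z)" for z
    have e': "e' (a @ x @ y) = e (a @ x @ y) - u a x y"
      if "a \<in> wordset S l" "x \<in> wordset S m" for a x y
      using that by (simp add: e'_def wordset_def)
    have split: "\<exists>a x y. z = a @ x @ y \<and> a \<in> wordset S l \<and> x \<in> wordset S m \<and> y \<in> wordset S n"
      if "z \<in> wordset S (l + (m + n))" for z
    proof (intro exI conjI)
      show "z = take l z @ take m (drop l z) @ drop (l + m) z"
        by (metis append_take_drop_id drop_drop add.commute)
    qed (use that in \<open>auto simp: wordset_def dest: in_set_takeD in_set_dropD\<close>)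
    have u_Q: "Q (\<lambda>a y. wexp S p m (\<lambda>x. h (a @ x @ y) * u a x y))
        = Q (\<lambda>a y. of_bool (good a y) * \<kappa> * wexp S p d (\<lambda>v. h (a @ sub (V a y) v @ y)))" for h
      unfolding Q_def by (intro wexp_cong) (simp add: u_exp[where h = "\<lambda>x. h (_ @ x @ _)"])
    have exp_e': "wexp S p (l + (m + n)) (\<lambda>z. h z * e' z) = wexp S p (l + (m + n)) (\<lambda>z. h z * e z)
        - Q (\<lambda>a y. wexp S p m (\<lambda>x. h (a @ x @ y) * u a x y))" for h
    proof -
      have "wexp S p (l + (m + n)) (\<lambda>z. h z * e' z) = Q (\<lambda>a y. wexp S p m (\<lambda>x.
          h (a @ x @ y) * e (a @ x @ y) - h (a @ x @ y) * u a x y))"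
        unfolding Q Q_def by (intro wexp_cong) (simp add: e' right_diff_distrib)
      then show ?thesis
        by (simp add: Q Q_def wexp_diff)
    qed
    have mass_e': "wexp S p (l + (m + n)) e' = wexp S p (l + (m + n)) e - \<kappa> * P"
      using exp_e'[of "\<lambda>_. 1"] u_Q[of "\<lambda>_. 1"]
      by (simp add: P_def Q_def wexp_const[OF w] wexp_cmult mult.commute)
    have IH: "wexp S p (l + (m + n)) (\<lambda>z. g z * e' z) \<le> \<eta> * wexp S p (l + (m + n)) e' + 3 * \<epsilon>"
    proof (rule Suc.IH[of "l + m" e', unfolded len])
      show "0 \<le> e' z \<and> e' z \<le> 1" if z_in: "z \<in> wordset S (l + (m + n))" for z
      proof -
        obtain a x y where z: "z = a @ x @ y" "a \<in> wordset S l" "x \<in> wordset S m" "y \<in> wordset S n"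
          using split[OF z_in] by blast
        then show ?thesis
          using u_le[OF z(2-4)] u_nonneg[OF z(3), of a y] e01[OF z_in] by (simp add: e')
      qed
      show "e' (b @ map r y) = e' (b @ y)"
        if b: "b \<in> wordset S (l + m)" and y: "y \<in> wordset S (s * m)" for b y
      proof -
        obtain a x where b: "b = a @ x" "a \<in> wordset S l" "x \<in> wordset S m"
          using b that[of "take l b" "drop l b"]
          by (auto simp: wordset_def dest: in_set_takeD in_set_dropD)
        have y: "y \<in> wordset S n" using y by (simp add: n_def)
        have "f a (map r y) = f a y"
          unfolding f_def using ins_right[OF b(2) _ y] by (intro wexp_cong)
        moreover have "E a (map r y) = E a y"
          unfolding E_def using ins_right[OF b(2) _ y] by auto
        ultimately have "u a x (map r y) = u a x y"
          by (simp add: u_def V_def good_def)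
        then show ?thesis
          using e'[OF b(2,3)] ins_right[OF b(2,3) y] b(1) by simp
      qed
      show "g z \<le> 1" if "z \<in> wordset S (l + (m + n))" for z
        using g1[OF that] .
      show "wexp S p d (\<lambda>v. g (sub V v)) \<le> \<eta>" if "V \<in> template S d (l + (m + n))" for V
        using subspaces[OF that] .
      \<comment> \<open>The step has removed mass \<open>\<kappa> * P\<close>, which is enough for
        the mass bound with one step fewer.\<close>
      have "\<kappa> * \<epsilon> \<le> \<kappa> * P"
        using False \<open>0 < \<kappa>\<close> by simp
      then show "wexp S p (l + (m + n)) e' \<le> s * (\<kappa> * \<epsilon>) + 3 * \<epsilon>"
        using mass unfolding mass_e' by (simp add: algebra_simps)
    qed
    \<comment> \<open>On each tile \<open>g\<close> averages at most \<open>\<eta>\<close>, so the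
      removed part contributes at most \<open>\<eta>\<close> times its mass.\<close>
    have "Q (\<lambda>a y. wexp S p m (\<lambda>x. g (a @ x @ y) * u a x y))
        \<le> Q (\<lambda>a y. (\<eta> * \<kappa>) * of_bool (good a y))"
      unfolding u_Q
    proof (rule Q_mono)
      fix a y assume a: "a \<in> wordset S l" and y: "y \<in> wordset S n"
      have "wexp S p d (\<lambda>v. g (a @ sub (V a y) v @ y)) \<le> \<eta>" if "good a y"
        using subspaces[OF template_append_const[OF conjunct1[OF V[OF a y that]] a y]]
        by (simp add: sub_append)
      then show "of_bool (good a y) * \<kappa> * wexp S p d (\<lambda>v. g (a @ sub (V a y) v @ y))
          \<le> \<eta> * \<kappa> * of_bool (good a y)"
        using \<open>0 < \<kappa>\<close> by (simp add: mult.commute)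
    qed
    also have "\<dots> = \<eta> * (\<kappa> * P)"
      by (simp add: Q_def P_def wexp_cmult mult.assoc)
    finally show ?thesis
      using IH unfolding len mass_e' exp_e' by (simp add: algebra_simps)
  qed
qed

section \<open>Insensitive functions and their products\<close>

definition collapse :: "'a \<Rightarrow> 'a \<Rightarrow> 'a \<Rightarrow> 'a" where
  "collapse q j c = (if c = q then j else c)"

text \<open>Invariance under collapsing all \<open>q\<close> at once amounts to invariance under
  exchanging \<open>q\<close> and \<open>j\<close> at any positions, since words related by such
  exchanges have the same collapse.\<close>

definition insensitive :: "'a set \<Rightarrow> nat \<Rightarrow> 'a \<Rightarrow> 'a \<Rightarrow> ('a list \<Rightarrow> real) \<Rightarrow> bool" where
  "insensitive S n q j e \<longleftrightarrow>
     (\<forall>w\<in>wordset S n. 0 \<le> e w \<and> e w \<le> 1 \<and> e (map (collapse q j) w) = e w)"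

lemma map_collapse_idem: "map (collapse q j) (map (collapse q j) w) = map (collapse q j) w"
  by (simp add: collapse_def)

lemma map_collapse_sub:
  assumes "T \<in> template S d n" "q \<notin> S" "length v = d"
  shows "map (collapse q j) (sub T v) = sub T (map (collapse q j) v)"
proof -
  have "collapse q j (letter v s) = letter (map (collapse q j) v) s" if "s \<in> set T" for s
    using that assms by (cases s) (auto simp: template_iff collapse_def)
  then show ?thesis by (simp add: sub_def)
qed

text \<open>Constants of \<open>V\<close> may equal \<open>q\<close>, so collapsing need not commute
  with \<open>sub V\<close>; but the points of \<open>V\<close> at \<open>v\<close> and at its
  collapse have the same collapse.\<close>

lemma insensitive_sub:
  assumes "insensitive S n q j e" "V \<in> template S d n" "q \<noteq> j" "j \<in> S"
  shows "insensitive S d q j (\<lambda>v. e (sub V v))"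
  unfolding insensitive_def
proof (intro ballI conjI)
  fix v assume v: "v \<in> wordset S d"
  note e = assms(1)[unfolded insensitive_def, rule_format]
  show "0 \<le> e (sub V v)" "e (sub V v) \<le> 1"
    using e[OF sub_in_wordset[OF assms(2) v]] by auto
  have v': "map (collapse q j) v \<in> wordset S d"
    using v assms(4) by (auto simp: wordset_def collapse_def)
  have "collapse q j (letter (map (collapse q j) v) s) = collapse q j (letter v s)" if "s \<in> set V" for s
    using that assms(2) v by (cases s) (auto simp: template_iff collapse_def wordset_def)
  then have "map (collapse q j) (sub V (map (collapse q j) v)) = map (collapse q j) (sub V v)"
    by (simp add: sub_def)
  then show "e (sub V (map (collapse q j) v)) = e (sub V v)"
    using e[OF sub_in_wordset[OF assms(2) v]] e[OF sub_in_wordset[OF assms(2) v']] by metis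
qed

lemma weights_pushforward:
  assumes "weights S p" "finite T" "f ` S = T" "\<And>c. c \<in> T \<Longrightarrow> q c = (\<Sum>s\<in>{s\<in>S. f s = c}. p s)"
  shows "weights T q"
proof -
  have "0 < q c" if c: "c \<in> T" for c
    unfolding assms(4)[OF c] using c assms(3) weights_finite[OF assms(1)] weights_pos[OF assms(1)]
    by (intro sum_pos) auto
  moreover have "sum q T = (\<Sum>c\<in>T. \<Sum>s\<in>{s\<in>S. f s = c}. p s)"
    by (simp add: assms(4))
  then have "sum q T = 1"
    using assms sum.group[of S T f p] by (simp add: weights_def)
  ultimately show ?thesis
    using assms(2) by (simp add: weights_def)
qed

text \<open>The intended \<open>g\<close> is the indicator of a line-free set minus a density bound,
  with \<open>\<eta> = 0\<close>. Positive \<open>\<eta>\<close> arises when other factors are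
  absorbed into \<open>g\<close>.\<close>

definition bounded_on_subspaces :: "'a set \<Rightarrow> ('a \<Rightarrow> real) \<Rightarrow> nat \<Rightarrow> real \<Rightarrow> nat \<Rightarrow> ('a list \<Rightarrow> real) \<Rightarrow> bool" where
  "bounded_on_subspaces S p d \<eta> n g \<longleftrightarrow> (\<forall>w\<in>wordset S n. g w \<le> 1) \<and>
     (\<forall>V\<in>template S d n. wexp S p d (\<lambda>v. g (sub V v)) \<le> \<eta>)"

text \<open>Under \<open>collapse q j\<close> an insensitive set is the preimage of its part over
  \<open>S\<close>, where \<open>dense\<close> yields a subspace; insensitivity extends this
  subspace to the letter \<open>q\<close>. This supplies the tiles for
  \<open>wexp_insensitive_le\<close>.\<close>

lemma wexp_insensitive:
  assumes dense: "dense_subspaces S d" and q: "q \<notin> S" and j: "j \<in> S"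
    and w: "weights (insert q S) p" and "0 < \<epsilon>"
  shows "\<exists>n0. \<forall>n\<ge>n0. \<forall>e g \<eta>. 0 \<le> \<eta> \<longrightarrow> insensitive (insert q S) n q j e \<longrightarrow>
    bounded_on_subspaces (insert q S) p d \<eta> n g \<longrightarrow>
    wexp (insert q S) p n (\<lambda>w. g w * e w) \<le> \<eta> + \<epsilon>"
proof -
  let ?S = "insert q S" and ?r = "collapse q j"
  have finS: "finite S" using weights_finite[OF w] by simp
  define p' where "p' c = (\<Sum>s\<in>{s\<in>?S. ?r s = c}. p s)" for c
  have r_image: "?r ` ?S = S"
    using q j by (force simp: collapse_def image_iff)
  then have w': "weights S p'"
    using w finS by (intro weights_pushforward[of ?S p S ?r]) (auto simp: p'_def)
  obtain m where m: "\<And>E. \<epsilon>/3 \<le> wexp S p' m (\<lambda>w. of_bool (w \<in> E)) \<Longrightarrow> has_subspace S d m E"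
    using dense w' \<open>0 < \<epsilon>\<close> unfolding dense_subspaces_def by (meson zero_less_divide_iff zero_less_numeral)
  have dense': "has_subspace ?S d m E"
    if E: "\<forall>x\<in>wordset ?S m. map ?r x \<in> E \<longleftrightarrow> x \<in> E"
      and big: "\<epsilon>/3 \<le> wexp ?S p m (\<lambda>x. of_bool (x \<in> E))" for E
  proof -
    have "wexp ?S p m (\<lambda>x. of_bool (x \<in> E)) = wexp ?S p m (\<lambda>x. of_bool (map ?r x \<in> E))"
      using E by (intro wexp_cong) simp
    also have "\<dots> = wexp S p' m (\<lambda>x. of_bool (x \<in> E))"
      using finS r_image by (intro wexp_map) (auto simp: p'_def)
    finally obtain T where T: "T \<in> template S d m" "\<forall>v\<in>wordset S d. sub T v \<in> E"
      using big m[of E] by (auto simp: has_subspace_def)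
    have T': "T \<in> template ?S d m"
      using T(1) template_mono[of S ?S d m] by blast
    have "sub T v \<in> E" if v: "v \<in> wordset ?S d" for v
    proof -
      have "map ?r v \<in> wordset S d"
        using v j by (auto simp: wordset_def collapse_def)
      then have "map ?r (sub T v) \<in> E"
        using T(2) map_collapse_sub[OF T(1) q] v by (simp add: wordset_def)
      then show ?thesis
        using E sub_in_wordset[OF T' v] by blast
    qed
    then show ?thesis
      using T' by (auto simp: has_subspace_def)
  qed
  obtain \<kappa>0 where \<kappa>0: "0 < \<kappa>0" "\<And>x. x \<in> wordset ?S m \<Longrightarrow> \<kappa>0 \<le> prod_list (map p x)"
    using min_word_weight[OF w] by metis
  define \<kappa> where "\<kappa> = \<epsilon>/3 * \<kappa>0"
  have "0 < \<kappa>" using \<kappa>0 \<open>0 < \<epsilon>\<close> by (simp add: \<kappa>_def)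
  \<comment> \<open>With so many steps, \<open>s * (\<kappa> * (\<epsilon>/3))\<close> exceeds the
    total mass of \<open>e\<close>, which is at most 1.\<close>
  obtain s :: nat where s: "1 / (\<kappa> * (\<epsilon>/3)) < s"
    using reals_Archimedean2 by blast
  then have s: "1 \<le> s * (\<kappa> * (\<epsilon>/3))"
    using \<open>0 < \<kappa>\<close> \<open>0 < \<epsilon>\<close> by (simp add: divide_less_eq)
  show ?thesis
  proof (intro exI[of _ "s * m"] allI impI)
    fix n e g and \<eta> :: real
    assume "s * m \<le> n" and "0 \<le> \<eta>" and e: "insensitive ?S n q j e"
      and "bounded_on_subspaces ?S p d \<eta> n g"
    then have g: "\<forall>w\<in>wordset ?S n. g w \<le> 1"
      and V: "\<forall>V\<in>template ?S d n. wexp ?S p d (\<lambda>v. g (sub V v)) \<le> \<eta>"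
      and n: "(n - s * m) + s * m = n"
      by (simp_all add: bounded_on_subspaces_def)
    have e01: "0 \<le> e w \<and> e w \<le> 1" and e_eq: "e (map ?r w) = e w" if "w \<in> wordset ?S n" for w
      using e that by (auto simp: insensitive_def)
    have e1: "wexp ?S p n e \<le> 1"
      using e01 by (intro wexp_le_const[OF w]) auto
    \<comment> \<open>Surplus letters go in front, as the exempt part of length
      \<open>n - s * m\<close>.\<close>
    have "wexp ?S p (n - s * m + s * m) (\<lambda>w. g w * e w)
        \<le> \<eta> * wexp ?S p (n - s * m + s * m) e + 3 * (\<epsilon>/3)"
    proof (rule wexp_insensitive_le[OF w, where r = ?r and \<kappa> = \<kappa> and d = d])
      show "?r c \<in> ?S" "?r (?r c) = ?r c" if "c \<in> ?S" for c
        using that j by (auto simp: collapse_def)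
      show "\<kappa> \<le> \<epsilon>/3 * prod_list (map p x)" if "x \<in> wordset ?S m" for x
        using \<kappa>0(2)[OF that] \<open>0 < \<epsilon>\<close> by (simp add: \<kappa>_def)
      show "e (a @ map ?r z) = e (a @ z)"
        if "a \<in> wordset ?S (n - s * m)" "z \<in> wordset ?S (s * m)" for a z
      proof -
        have "map ?r z \<in> wordset ?S (s * m)"
          using that(2) j by (auto simp: wordset_def collapse_def)
        then have "a @ z \<in> wordset ?S n" "a @ map ?r z \<in> wordset ?S n"
          using append_in_wordset[OF that] append_in_wordset[OF that(1)] n by metis+
        then have "e (map ?r (a @ map ?r z)) = e (a @ map ?r z)" "e (map ?r (a @ z)) = e (a @ z)"
          by (auto simp only: e_eq)
        moreover have "map ?r (a @ map ?r z) = map ?r (a @ z)"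
          by (auto simp: collapse_def)
        ultimately show ?thesis by metis
      qed
      show "wexp ?S p (n - s * m + s * m) e \<le> s * (\<kappa> * (\<epsilon>/3)) + 3 * (\<epsilon>/3)"
        using e1 s \<open>0 < \<epsilon>\<close> unfolding n by linarith
    qed (use dense' e01 g V \<open>0 < \<epsilon>\<close> \<open>0 < \<kappa>\<close> \<open>0 \<le> \<eta>\<close> n in auto)
    also have "\<eta> * wexp ?S p (n - s * m + s * m) e \<le> \<eta>"
      unfolding n using e1 \<open>0 \<le> \<eta>\<close> by (simp add: mult_left_le)
    finally show "wexp ?S p n (\<lambda>w. g w * e w) \<le> \<eta> + \<epsilon>"
      by (simp add: n)
  qed
qed

text \<open>Induction on \<open>J\<close>: tile \<open>e i\<close> by subspaces of a dimension
  \<open>n1\<close> to which the induction hypothesis applies. On each tile the other factors stay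
  insensitive, so \<open>g\<close> times their product averages at most \<open>\<epsilon>/2\<close>,
  the \<open>\<eta>\<close> for \<open>wexp_insensitive\<close>.\<close>

lemma wexp_insensitive_prod:
  assumes dense: "\<And>d. dense_subspaces S d" and q: "q \<notin> S"
    and w: "weights (insert q S) p"
  shows "finite J \<Longrightarrow> J \<subseteq> S \<Longrightarrow> 0 < \<epsilon> \<Longrightarrow>
   \<exists>n0. \<forall>n\<ge>n0. \<forall>e g. (\<forall>j\<in>J. insensitive (insert q S) n q j (e j)) \<longrightarrow>
    bounded_on_subspaces (insert q S) p d 0 n g \<longrightarrow>
    wexp (insert q S) p n (\<lambda>w. g w * (\<Prod>j\<in>J. e j w)) \<le> \<epsilon>"
proof (induction J arbitrary: \<epsilon> rule: finite_induct)
  case empty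
  let ?S = "insert q S"
  obtain n0 where n0: "(1 - 1/2 :: real) ^ n0 < \<epsilon> / 2 ^ d"
    using real_arch_pow_inv[of "\<epsilon> / 2 ^ d" "1 - 1/2"] empty by auto
  have "wexp ?S p n g \<le> \<epsilon>" if "n0 \<le> n" and g: "bounded_on_subspaces ?S p d 0 n g" for n g
  proof -
    \<comment> \<open>With equal measures and \<open>l = 1\<close> in \<open>wexp_transfer\<close>,
      every position is a potential wildcard.\<close>
    have "wexp ?S p n g \<le> 0 + 2 ^ d * (1 - 1/2) ^ n"
      using g by (intro wexp_transfer[OF w w, where l = 1]) (auto simp: bounded_on_subspaces_def)
    also have "\<dots> \<le> 2 ^ d * (1 - 1/2) ^ n0"
      using power_decreasing[OF \<open>n0 \<le> n\<close>, of "1 - 1/2 :: real"] by simp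
    also have "\<dots> \<le> \<epsilon>"
      using n0 by (simp add: field_simps)
    finally show ?thesis .
  qed
  then show ?case by (intro exI[of _ n0]) simp
next
  case (insert i J)
  let ?S = "insert q S"
  have i: "i \<in> S" and J: "J \<subseteq> S" and \<epsilon>: "0 < \<epsilon>/2"
    using insert.prems by auto
  obtain n1 where n1: "\<forall>n\<ge>n1. \<forall>e g. (\<forall>j\<in>J. insensitive ?S n q j (e j)) \<longrightarrow>
      bounded_on_subspaces ?S p d 0 n g \<longrightarrow>
      wexp ?S p n (\<lambda>w. g w * (\<Prod>j\<in>J. e j w)) \<le> \<epsilon>/2"
    using insert.IH[OF J \<epsilon>] by (rule exE)
  obtain n0 where n0: "\<forall>n\<ge>n0. \<forall>e g \<eta>. 0 \<le> \<eta> \<longrightarrow> insensitive ?S n q i e \<longrightarrow>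
      bounded_on_subspaces ?S p n1 \<eta> n g \<longrightarrow>
      wexp ?S p n (\<lambda>w. g w * e w) \<le> \<eta> + \<epsilon>/2"
    using wexp_insensitive[OF dense q i w \<epsilon>] by (rule exE)
  show ?case
  proof (intro exI[of _ n0] allI impI)
    fix n and e :: "'a \<Rightarrow> 'a list \<Rightarrow> real" and g
    assume n: "n0 \<le> n" and e: "\<forall>j\<in>insert i J. insensitive ?S n q j (e j)"
      and g: "bounded_on_subspaces ?S p d 0 n g"
    let ?h = "\<lambda>w. g w * (\<Prod>j\<in>J. e j w)"
    have "?h w \<le> 1" if "w \<in> wordset ?S n" for w
    proof -
      have "0 \<le> (\<Prod>j\<in>J. e j w)" "(\<Prod>j\<in>J. e j w) \<le> 1"
        using e that by (auto simp: insensitive_def intro!: prod_nonneg prod_le_1)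
      moreover have "g w \<le> 1" using g that by (simp add: bounded_on_subspaces_def)
      ultimately show ?thesis
        using mult_le_right order_trans by blast
    qed
    moreover have "wexp ?S p n1 (\<lambda>v. ?h (sub U v)) \<le> \<epsilon>/2" if U: "U \<in> template ?S n1 n" for U
    proof -
      have "\<forall>j\<in>J. insensitive ?S n1 q j (\<lambda>v. e j (sub U v))"
      proof
        fix j assume j: "j \<in> J"
        then have "j \<in> S" using J by blast
        then have "q \<noteq> j" using q by blast
        moreover have "insensitive ?S n q j (e j)" using e j by simp
        ultimately show "insensitive ?S n1 q j (\<lambda>v. e j (sub U v))"
          using insensitive_sub[OF _ U] \<open>j \<in> S\<close> by simp
      qed
      moreover have "bounded_on_subspaces ?S p d 0 n1 (\<lambda>v. g (sub U v))"
        unfolding bounded_on_subspaces_def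
      proof (intro conjI ballI)
        show "g (sub U w) \<le> 1" if "w \<in> wordset ?S n1" for w
          using g sub_in_wordset[OF U that] by (simp add: bounded_on_subspaces_def)
        show "wexp ?S p d (\<lambda>v. g (sub U (sub V v))) \<le> 0" if V: "V \<in> template ?S d n1" for V
          using conjunct2[OF g[unfolded bounded_on_subspaces_def], THEN bspec, OF template_comp_in[OF U V]]
          by (simp only: sub_template_comp[OF U V])
      qed
      ultimately show ?thesis
        by (rule n1[THEN spec, THEN mp, OF order_refl, THEN spec, THEN spec, THEN mp, THEN mp])
    qed
    ultimately have "bounded_on_subspaces ?S p n1 (\<epsilon>/2) n ?h"
      by (simp add: bounded_on_subspaces_def)
    moreover have "insensitive ?S n q i (e i)" using e by simp
    ultimately have "wexp ?S p n (\<lambda>w. ?h w * e i w) \<le> \<epsilon>/2 + \<epsilon>/2"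
      by (intro n0[THEN spec, THEN mp, OF n, THEN spec, THEN spec, THEN spec, THEN mp, THEN mp, THEN mp]
          less_imp_le[OF \<epsilon>])
    then show "wexp ?S p n (\<lambda>w. g w * (\<Prod>j\<in>insert i J. e j w)) \<le> \<epsilon>"
      using insert.hyps by (simp add: mult_ac)
  qed
qed

text \<open>For new \<open>i\<close>, \<open>1 - (\<Prod>j\<in>insert i J. e j)\<close> is the sum
  of \<open>1 - (\<Prod>j\<in>J. e j)\<close> and \<open>(1 - e i) * (\<Prod>j\<in>J. e j)\<close>.
  The latter is a product of insensitive functions, since \<open>1 - e i\<close> is insensitive
  too.\<close>

lemma wexp_insensitive_compl:
  assumes dense: "\<And>d. dense_subspaces S d" and q: "q \<notin> S"
    and w: "weights (insert q S) p"
  shows "finite J \<Longrightarrow> J \<subseteq> S \<Longrightarrow> 0 < \<epsilon> \<Longrightarrow>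
   \<exists>n0. \<forall>n\<ge>n0. \<forall>e g. (\<forall>j\<in>J. insensitive (insert q S) n q j (e j)) \<longrightarrow>
    bounded_on_subspaces (insert q S) p d 0 n g \<longrightarrow>
    wexp (insert q S) p n (\<lambda>w. g w * (1 - (\<Prod>j\<in>J. e j w))) \<le> \<epsilon>"
proof (induction J arbitrary: \<epsilon> rule: finite_induct)
  case (insert i J)
  let ?S = "insert q S"
  have J: "J \<subseteq> S" and \<epsilon>: "0 < \<epsilon>/2" and fin: "finite (insert i J)"
    using insert.prems insert.hyps by auto
  obtain n1 where n1: "\<forall>n\<ge>n1. \<forall>e g. (\<forall>j\<in>J. insensitive ?S n q j (e j)) \<longrightarrow>
      bounded_on_subspaces ?S p d 0 n g \<longrightarrow>
      wexp ?S p n (\<lambda>w. g w * (1 - (\<Prod>j\<in>J. e j w))) \<le> \<epsilon>/2"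
    using insert.IH[OF J \<epsilon>] by (rule exE)
  obtain n2 where n2: "\<forall>n\<ge>n2. \<forall>e g. (\<forall>j\<in>insert i J. insensitive ?S n q j (e j)) \<longrightarrow>
      bounded_on_subspaces ?S p d 0 n g \<longrightarrow>
      wexp ?S p n (\<lambda>w. g w * (\<Prod>j\<in>insert i J. e j w)) \<le> \<epsilon>/2"
    using wexp_insensitive_prod[OF dense q w fin insert.prems(1) \<epsilon>] by (rule exE)
  show ?case
  proof (intro exI[of _ "max n1 n2"] allI impI)
    fix n and e :: "'a \<Rightarrow> 'a list \<Rightarrow> real" and g
    assume n: "max n1 n2 \<le> n" and e: "\<forall>j\<in>insert i J. insensitive ?S n q j (e j)"
      and g: "bounded_on_subspaces ?S p d 0 n g"
    define e' where "e' = e(i := \<lambda>w. 1 - e i w)"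
    have "\<forall>j\<in>insert i J. insensitive ?S n q j (e' j)"
      using e by (auto simp: insensitive_def e'_def)
    from n2[THEN spec, THEN mp, THEN spec, THEN spec, THEN mp, THEN mp, OF _ this g]
    have "wexp ?S p n (\<lambda>w. g w * (\<Prod>j\<in>insert i J. e' j w)) \<le> \<epsilon>/2"
      using n by simp
    moreover have "(\<Prod>j\<in>J. e' j w) = (\<Prod>j\<in>J. e j w)" for w
      using insert.hyps by (intro prod.cong) (auto simp: e'_def)
    ultimately have "wexp ?S p n (\<lambda>w. g w * ((1 - e i w) * (\<Prod>j\<in>J. e j w))) \<le> \<epsilon>/2"
      using insert.hyps by (simp add: e'_def)
    moreover have "wexp ?S p n (\<lambda>w. g w * (1 - (\<Prod>j\<in>J. e j w))) \<le> \<epsilon>/2"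
    proof (rule n1[THEN spec, THEN mp, THEN spec, THEN spec, THEN mp, THEN mp])
      show "\<forall>j\<in>J. insensitive ?S n q j (e j)" using e by simp
    qed (use n g in simp_all)
    moreover have "wexp ?S p n (\<lambda>w. g w * (1 - (\<Prod>j\<in>insert i J. e j w))) =
        wexp ?S p n (\<lambda>w. g w * (1 - (\<Prod>j\<in>J. e j w)) + g w * ((1 - e i w) * (\<Prod>j\<in>J. e j w)))"
      using insert.hyps by (simp add: algebra_simps)
    ultimately show "wexp ?S p n (\<lambda>w. g w * (1 - (\<Prod>j\<in>insert i J. e j w))) \<le> \<epsilon>"
      by (simp add: wexp_add)
  qed
qed simp

section \<open>The density Hales-Jewett theorem\<close>

lemma wexp_avoid:
  assumes w: "weights S p" and "q \<in> S"
  shows "wexp S p n (\<lambda>w. of_bool (q \<notin> set w)) = (1 - p q) ^ n"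
proof (induction n)
  case (Suc n)
  have "wexp S p n (\<lambda>w. of_bool (q \<notin> set (c # w))) = of_bool (c \<noteq> q) * (1 - p q) ^ n" for c
    using Suc by (cases "c = q") simp_all
  then have "wexp S p (Suc n) (\<lambda>w. of_bool (q \<notin> set w)) = (\<Sum>c\<in>S. p c * of_bool (c \<noteq> q)) * (1 - p q) ^ n"
    by (simp only: wexp.simps sum_distrib_right mult.assoc)
  also have "(\<Sum>c\<in>S. p c * of_bool (c \<noteq> q)) = (\<Sum>c\<in>S - {q}. p c)"
    using weights_finite[OF w] by (intro sum.mono_neutral_cong_right) auto
  also have "\<dots> = 1 - p q"
    using w \<open>q \<in> S\<close> by (simp add: weights_def sum_diff1)
  finally show ?case by simp
qed simp

text \<open>Turn the letters \<open>q\<close> of \<open>t\<close> into wildcards: the point of this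
  line at \<open>q\<close> is \<open>t\<close> itself, the others are the collapses.\<close>

lemma has_line_of_word:
  assumes "t \<in> wordset (insert q S) n" "q \<in> set t" "t \<in> A" "\<And>j. j \<in> S \<Longrightarrow> map (collapse q j) t \<in> A"
  shows "has_subspace (insert q S) 1 n A"
proof -
  let ?T = "map (\<lambda>c. if c = q then Inr (0::nat) else Inl c) t"
  have "?T \<in> template (insert q S) 1 n"
  proof -
    have "set ?T \<subseteq> insert q S <+> {..<1}"
      using assms(1) by (auto simp: wordset_def)
    moreover have "Inr 0 \<in> set ?T"
      unfolding set_map using assms(2) by (intro image_eqI[of _ _ q]) simp_all
    ultimately show ?thesis
      using assms(1) by (simp add: template_iff wordset_def)
  qed
  moreover have "sub ?T v \<in> A" if v: "v \<in> wordset (insert q S) 1" for v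
  proof -
    obtain j where j: "v = [j]" "j \<in> insert q S"
      using v by (auto simp: wordset_def length_Suc_conv)
    have "sub ?T v = map (collapse q j) t"
      by (simp add: sub_def j(1) collapse_def)
    moreover have "map (collapse q q) t = t"
      by (auto simp: collapse_def intro: map_idI)
    ultimately show ?thesis
      using assms(3,4) j(2) by (cases "j = q") auto
  qed
  ultimately show ?thesis
    by (auto simp: has_subspace_def)
qed

text \<open>Line-freeness passes to subspaces, so \<open>b\<close> bounds the
  \<open>p0\<close>-average over every \<open>n\<close>-dimensional subspace;
  \<open>wexp_transfer\<close> turns this into a bound for \<open>p\<close> in large
  dimension.\<close>

lemma line_free_density_transfer:
  assumes w: "weights S p" and w0: "weights S p0" and "0 \<le> b" "0 < \<epsilon>"
    and b: "\<And>A. \<not> has_subspace S 1 n A \<Longrightarrow> wexp S p0 n (\<lambda>w. of_bool (w \<in> A)) \<le> b"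
  obtains d where "\<And>A. \<not> has_subspace S 1 d A \<Longrightarrow> wexp S p d (\<lambda>w. of_bool (w \<in> A)) \<le> b + \<epsilon>"
proof -
  obtain \<kappa> where \<kappa>: "0 < \<kappa>" "\<And>v. v \<in> wordset S 1 \<Longrightarrow> \<kappa> \<le> prod_list (map p v)"
    using min_word_weight[OF w] by metis
  define l where "l = min \<kappa> 1"
  have l: "0 < l" "l \<le> 1" using \<kappa> by (auto simp: l_def)
  have "l * p0 c \<le> p c" if "c \<in> S" for c
  proof -
    have "p0 c \<le> 1"
      using member_le_sum[of c S p0] w0 that by (auto simp: weights_def less_imp_le)
    then have "l * p0 c \<le> l" using l by (simp add: mult_left_le)
    also have "l \<le> p c" using \<kappa>(2)[of "[c]"] that by (simp add: l_def wordset_def)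
    finally show ?thesis .
  qed
  note transfer = wexp_transfer[OF w w0 less_imp_le[OF l(1)] l(2) this \<open>0 \<le> b\<close>]
  obtain d where "(1 - l / 2) ^ d < \<epsilon> / 2 ^ n"
    using real_arch_pow_inv[of "\<epsilon> / 2 ^ n" "1 - l / 2"] l \<open>0 < \<epsilon>\<close> by auto
  then have d: "2 ^ n * (1 - l / 2) ^ d < \<epsilon>"
    by (simp add: field_simps)
  have "wexp S p d (\<lambda>w. of_bool (w \<in> A)) \<le> b + \<epsilon>" if "\<not> has_subspace S 1 d A" for A
  proof -
    have "wexp S p0 n (\<lambda>v. of_bool (sub T v \<in> A)) \<le> b" if T: "T \<in> template S n d" for T
      using b[of "{v. sub T v \<in> A}"] has_subspace_pullback[OF T] \<open>\<not> has_subspace S 1 d A\<close> by auto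
    then have "wexp S p d (\<lambda>w. of_bool (w \<in> A)) \<le> b + 2 ^ n * (1 - l / 2) ^ d"
      by (intro transfer) auto
    then show ?thesis using d by simp
  qed
  then show ?thesis by (rule that)
qed

text \<open>The product is the indicator \<open>C\<close> of the words all of whose collapses lie in
  \<open>A\<close>. Such a word is outside \<open>A\<close> if it contains \<open>q\<close>, as
  \<open>A\<close> has no line, and words without \<open>q\<close> are rare. Off \<open>C\<close>,
  \<open>wexp_insensitive_compl\<close> applies to the indicator of \<open>A\<close> minus
  \<open>a + \<epsilon>\<close>.\<close>

lemma line_free_bound:
  assumes dense: "\<And>d. dense_subspaces S d" and q: "q \<notin> S"
    and w: "weights (insert q S) p" and w0: "weights (insert q S) p0"
    and "0 \<le> a" "0 < \<epsilon>"
    and up: "\<And>A. \<not> has_subspace (insert q S) 1 m A \<Longrightarrow> wexp (insert q S) p0 m (\<lambda>w. of_bool (w \<in> A)) \<le> a + \<epsilon>/2"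
  shows "\<exists>n0. \<forall>n\<ge>n0. \<forall>A. \<not> has_subspace (insert q S) 1 n A \<longrightarrow>
    wexp (insert q S) p n (\<lambda>w. of_bool (w \<in> A)) \<le> 2 * \<epsilon> +
      (a + \<epsilon>) * (1 - wexp (insert q S) p n (\<lambda>w. \<Prod>j\<in>S. of_bool (map (collapse q j) w \<in> A)))"
proof -
  let ?S = "insert q S"
  have finS: "finite S" using weights_finite[OF w] by simp
  obtain d where d: "\<And>A. \<not> has_subspace ?S 1 d A \<Longrightarrow> wexp ?S p d (\<lambda>w. of_bool (w \<in> A)) \<le> a + \<epsilon>"
    using line_free_density_transfer[OF w w0 _ _ up, of "\<epsilon>/2"] \<open>0 \<le> a\<close> \<open>0 < \<epsilon>\<close> by (auto simp: add.assoc)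
  obtain n1 where n1: "\<forall>n\<ge>n1. \<forall>e g. (\<forall>j\<in>S. insensitive ?S n q j (e j)) \<longrightarrow>
      bounded_on_subspaces ?S p d 0 n g \<longrightarrow>
      wexp ?S p n (\<lambda>w. g w * (1 - (\<Prod>j\<in>S. e j w))) \<le> \<epsilon>"
    using wexp_insensitive_compl[OF dense q w finS order_refl \<open>0 < \<epsilon>\<close>] by (rule exE)
  have pq: "0 < p q" "p q \<le> 1"
    using weights_pos[OF w] member_le_sum[of q ?S p] w by (auto simp: weights_def less_imp_le)
  obtain n2 where n2: "(1 - p q) ^ n2 < \<epsilon>"
    using real_arch_pow_inv[of \<epsilon> "1 - p q"] pq \<open>0 < \<epsilon>\<close> by auto
  have "wexp ?S p n (\<lambda>w. of_bool (w \<in> A)) \<le> 2 * \<epsilon> + (a + \<epsilon>) * (1 - wexp ?S p n (\<lambda>w. \<Prod>j\<in>S. of_bool (map (collapse q j) w \<in> A)))"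
    if n: "max n1 n2 \<le> n" and A: "\<not> has_subspace ?S 1 n A" for n A
  proof -
    define e where "e j w = (of_bool (map (collapse q j) w \<in> A) :: real)" for j w
    define C where "C w = (\<Prod>j\<in>S. e j w)" for w
    have tail: "wexp ?S p n (\<lambda>w. (of_bool (w \<in> A) - (a + \<epsilon>)) * (1 - (\<Prod>j\<in>S. e j w))) \<le> \<epsilon>"
    proof (rule n1[THEN spec, THEN mp, THEN spec, THEN spec, THEN mp, THEN mp])
      show "\<forall>j\<in>S. insensitive ?S n q j (e j)"
        by (simp add: insensitive_def e_def map_collapse_idem del: map_map)
      show "bounded_on_subspaces ?S p d 0 n (\<lambda>w. of_bool (w \<in> A) - (a + \<epsilon>))"
        unfolding bounded_on_subspaces_def
      proof (intro conjI ballI)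
        show "of_bool (w \<in> A) - (a + \<epsilon>) \<le> 1" for w
          using \<open>0 \<le> a\<close> \<open>0 < \<epsilon>\<close> by (simp add: of_bool_def)
        fix V assume V: "V \<in> template ?S d n"
        then have "\<not> has_subspace ?S 1 d {v. sub V v \<in> A}"
          using has_subspace_pullback[OF V] A by blast
        from d[OF this] show "wexp ?S p d (\<lambda>v. of_bool (sub V v \<in> A) - (a + \<epsilon>)) \<le> 0"
          by (simp add: wexp_diff wexp_const[OF w])
      qed
    qed (use n in simp)
    have "wexp ?S p n (\<lambda>w. of_bool (w \<in> A) * C w) \<le> wexp ?S p n (\<lambda>w. of_bool (q \<notin> set w))"
    proof (rule wexp_mono[OF w])
      fix t assume t: "t \<in> wordset ?S n"
      show "of_bool (t \<in> A) * C t \<le> of_bool (q \<notin> set t)"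
      proof (cases "q \<in> set t \<and> t \<in> A")
        case True
        then obtain j where "j \<in> S" "e j t = 0"
          using has_line_of_word[OF t] A by (auto simp: e_def)
        then have "C t = 0" using finS by (auto simp: C_def)
        then show ?thesis by simp
      next
        case False
        have "C t \<le> 1" by (auto simp: C_def e_def intro!: prod_le_1)
        then show ?thesis using False by auto
      qed
    qed
    also have "\<dots> \<le> \<epsilon>"
      using wexp_avoid[OF w, of q n] power_decreasing[of n2 n "1 - p q"] n n2 pq by simp
    finally have "wexp ?S p n (\<lambda>w. of_bool (w \<in> A) * C w) \<le> \<epsilon>" .
    moreover have "wexp ?S p n (\<lambda>w. (of_bool (w \<in> A) - (a + \<epsilon>)) * (1 - C w))
        = wexp ?S p n (\<lambda>w. (of_bool (w \<in> A) - of_bool (w \<in> A) * C w) - ((a + \<epsilon>) - (a + \<epsilon>) * C w))"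
      by (simp add: algebra_simps)
    then have "wexp ?S p n (\<lambda>w. (of_bool (w \<in> A) - (a + \<epsilon>)) * (1 - C w))
        = wexp ?S p n (\<lambda>w. of_bool (w \<in> A)) - wexp ?S p n (\<lambda>w. of_bool (w \<in> A) * C w)
          - ((a + \<epsilon>) - (a + \<epsilon>) * wexp ?S p n C)"
      by (simp add: wexp_diff wexp_cmult wexp_const[OF w])
    ultimately show ?thesis
      using tail unfolding C_def[abs_def] e_def by (simp add: algebra_simps)
  qed
  then show ?thesis by blast
qed

text \<open>\<open>up\<close> and \<open>lo\<close> say that \<open>a\<close> is the limiting
  maximal density of line-free sets. For an almost extremal \<open>A\<close> the average density of
  its sections is computed under some \<open>\<nu> u\<close>: it is at least
  \<open>a - \<epsilon>\<close>, yet \<open>line_free_bound\<close> pushes it below that.\<close>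

lemma no_extremal_density:
  assumes dense: "\<And>d. dense_subspaces S d" and q: "q \<notin> S" and "S \<noteq> {}"
    and w0: "weights (insert q S) p0" and "0 < a"
    and up: "\<And>b. a < b \<Longrightarrow> \<exists>n. \<forall>A. \<not> has_subspace (insert q S) 1 n A \<longrightarrow>
        wexp (insert q S) p0 n (\<lambda>w. of_bool (w \<in> A)) \<le> b"
    and lo: "\<And>b n. b < a \<Longrightarrow> \<exists>A. \<not> has_subspace (insert q S) 1 n A \<and>
        b < wexp (insert q S) p0 n (\<lambda>w. of_bool (w \<in> A))"
  shows False
proof -
  let ?S = "insert q S"
  have finS: "finite S" using weights_finite[OF w0] by simp
  define pk where "pk c = 1 / card S" for c :: 'a
  have wk: "weights S pk"
    using finS \<open>S \<noteq> {}\<close> by (auto simp: weights_def pk_def card_gt_0_iff)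
  \<comment> \<open>Sections will have density at least \<open>a/2\<close>; the reverse Markov
    inequality splits this into \<open>a/4 + a/4\<close>.\<close>
  obtain m where m: "\<And>A. a/4 \<le> wexp S pk m (\<lambda>w. of_bool (w \<in> A)) \<Longrightarrow> has_subspace S 1 m A"
    using dense[of 1] wk \<open>0 < a\<close> unfolding dense_subspaces_def by (meson zero_less_divide_iff zero_less_numeral)
  \<comment> \<open>A word of \<open>U\<close> encodes a potential line over \<open>S\<close>, with
    \<open>q\<close> marking the wildcard.\<close>
  define U where "U = {u \<in> wordset ?S m. q \<in> set u}"
  have finU: "finite U" using finS by (simp add: U_def finite_wordset)
  \<comment> \<open>Every subspace with constants in \<open>S\<close> is hit by a line on a fixed proportion of the sections. In a
    random subspace (template with independent \<open>\<rho>\<close>-distributed letters) each line \<open>u\<close> becomes a word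
    with independent letters of law \<open>\<nu> u\<close>, so product measures suffice and no Ramsey theorem for
    lines is needed.\<close>
  let ?L = "S <+> {..<m}"
  define \<rho> where "\<rho> s = 1 / card ?L" for s :: "'a + nat"
  have w\<rho>: "weights ?L \<rho>"
    using finS \<open>S \<noteq> {}\<close> by (auto simp: weights_def \<rho>_def card_gt_0_iff)
  define \<nu> where "\<nu> u c = (\<Sum>s\<in>{s\<in>?L. letter u s = c}. \<rho> s)" for u c
  have image: "letter u ` ?L = ?S" if "u \<in> U" for u
  proof -
    have u: "length u = m" "set u \<subseteq> ?S" "q \<in> set u"
      using that by (auto simp: U_def wordset_def)
    then obtain i where "i < m" "u ! i = q" by (auto simp: in_set_conv_nth)
    then have "q \<in> letter u ` ?L" by (intro image_eqI[of _ _ "Inr i"]) auto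
    moreover have "c \<in> letter u ` ?L" if "c \<in> S" for c
      using that by (intro image_eqI[of _ _ "Inl c"]) auto
    moreover have "letter u s \<in> ?S" if "s \<in> ?L" for s
    proof (rule letter_in)
      show "s \<in> ?S <+> {..<m}" using that by (auto simp: Plus_def)
      show "u \<in> wordset ?S m" using u by (simp add: wordset_def)
    qed
    ultimately show ?thesis by blast
  qed
  have w\<nu>: "weights ?S (\<nu> u)" if "u \<in> U" for u
    using finS by (intro weights_pushforward[OF w\<rho> _ image[OF that]]) (auto simp: \<nu>_def)
  have \<nu>: "wexp ?L \<rho> n (\<lambda>\<tau>. F (sub \<tau> u)) = wexp ?S (\<nu> u) n F" if "u \<in> U" for u n and F :: "'a list \<Rightarrow> real"
    unfolding sub_def using finS image[OF that] by (intro wexp_map) (auto simp: \<nu>_def)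
  \<comment> \<open>The measure \<open>a/4\<close> is shared among the candidates in
    \<open>U\<close>; the \<open>+ 1\<close> avoids a zero divisor.\<close>
  define \<theta> where "\<theta> = a/4 / (card U + 1)"
  have "0 < \<theta>" using \<open>0 < a\<close> by (simp add: \<theta>_def)
  \<comment> \<open>\<open>5 * \<epsilon> \<le> a * \<theta>\<close> lets the gain beat the errors,
    which add up to \<open>4 * \<epsilon>\<close>; \<open>\<epsilon> \<le> a / 2\<close> keeps the
    sections at density \<open>a / 2\<close>.\<close>
  define \<epsilon> where "\<epsilon> = min (a * \<theta> / 5) (a / 2)"
  have "0 < \<epsilon>" "5 * \<epsilon> \<le> a * \<theta>" "\<epsilon> \<le> a / 2"
    using \<open>0 < \<theta>\<close> \<open>0 < a\<close> by (auto simp: \<epsilon>_def)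
  obtain m' where "\<And>A. \<not> has_subspace ?S 1 m' A \<Longrightarrow> wexp ?S p0 m' (\<lambda>w. of_bool (w \<in> A)) \<le> a + \<epsilon>/2"
    using up[of "a + \<epsilon>/2"] \<open>0 < \<epsilon>\<close> by auto
  note bound = line_free_bound[OF dense q _ w0 less_imp_le[OF \<open>0 < a\<close>] \<open>0 < \<epsilon>\<close> this]
  define good where "good u n \<longleftrightarrow> (\<forall>A. \<not> has_subspace ?S 1 n A \<longrightarrow>
    wexp ?S (\<nu> u) n (\<lambda>w. of_bool (w \<in> A)) \<le> 2 * \<epsilon> +
      (a + \<epsilon>) * (1 - wexp ?S (\<nu> u) n (\<lambda>w. \<Prod>j\<in>S. of_bool (map (collapse q j) w \<in> A))))" for u n
  \<comment> \<open>The line \<open>u\<close> is chosen only after \<open>A\<close>, so one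
    \<open>n1\<close> has to serve all of the finite set \<open>U\<close>.\<close>
  have "\<forall>u\<in>U. eventually (good u) sequentially"
    using bound[OF w\<nu>] unfolding eventually_sequentially good_def by blast
  then have "eventually (\<lambda>n. \<forall>u\<in>U. good u n) sequentially"
    by (simp add: eventually_ball_finite_distrib finU)
  then obtain n1 where n1: "\<And>u. u \<in> U \<Longrightarrow> good u n1"
    by (auto simp: eventually_sequentially)
  obtain \<kappa> where \<kappa>: "0 < \<kappa>" "\<And>t. t \<in> wordset ?S n1 \<Longrightarrow> \<kappa> \<le> prod_list (map p0 t)"
    using min_word_weight[OF w0] by metis
  define \<epsilon>' where "\<epsilon>' = \<epsilon> * \<kappa> / 2"
  have "0 < \<epsilon>'" using \<kappa> \<open>0 < \<epsilon>\<close> by (simp add: \<epsilon>'_def)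
  obtain n2 where n2: "\<And>A. \<not> has_subspace ?S 1 n2 A \<Longrightarrow> wexp ?S p0 n2 (\<lambda>w. of_bool (w \<in> A)) \<le> a + \<epsilon>'"
    using up[of "a + \<epsilon>'"] \<open>0 < \<epsilon>'\<close> by auto
  obtain A where A: "\<not> has_subspace ?S 1 (n1 + n2) A"
      "a - \<epsilon>' < wexp ?S p0 (n1 + n2) (\<lambda>w. of_bool (w \<in> A))"
    using lo[of "a - \<epsilon>'" "n1 + n2"] \<open>0 < \<epsilon>'\<close> by auto
  define D where "D t = wexp ?S p0 n2 (\<lambda>y. of_bool (t @ y \<in> A))" for t
  have D_up: "D t \<le> a + \<epsilon>'" if "t \<in> wordset ?S n1" for t
    using n2[of "{y. t @ y \<in> A}"] has_subspace_section_left[OF that] A(1) by (auto simp: D_def)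
  \<comment> \<open>The word \<open>t\<close> has weight at least \<open>\<kappa>\<close>, so a
    deficit above \<open>\<epsilon>\<close> there costs at least
    \<open>\<epsilon> * \<kappa> = 2 * \<epsilon>'\<close>; the other sections, at most
    \<open>a + \<epsilon>'\<close>, cannot make up for it.\<close>
  have D_lo: "a - \<epsilon> \<le> D t" if t: "t \<in> wordset ?S n1" for t
  proof (rule ccontr)
    assume "\<not> a - \<epsilon> \<le> D t"
    then have "wexp ?S p0 n1 D \<le> wexp ?S p0 n1 (\<lambda>x. (a + \<epsilon>') - (\<epsilon> + \<epsilon>') * of_bool (x = t))"
      using D_up by (intro wexp_mono[OF w0]) (auto simp: of_bool_def)
    also have "\<dots> = (a + \<epsilon>') - (\<epsilon> + \<epsilon>') * prod_list (map p0 t)"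
      by (simp add: wexp_diff wexp_const[OF w0] wexp_cmult wexp_point[OF w0 t])
    also have "\<dots> \<le> (a + \<epsilon>') - \<epsilon> * \<kappa>"
      using \<kappa>(1) \<kappa>(2)[OF t] \<open>0 < \<epsilon>\<close> \<open>0 < \<epsilon>'\<close> by (intro diff_left_mono mult_mono) auto
    also have "\<dots> = a - \<epsilon>'" by (simp add: \<epsilon>'_def)
    finally show False using A(2) by (simp add: wexp_append D_def[abs_def])
  qed
  \<comment> \<open>The measure of those \<open>y\<close> for which all points at letters of
    \<open>S\<close> of the line \<open>u\<close>, carried along \<open>\<tau>\<close>, lie in the
    section of \<open>A\<close> at \<open>y\<close>.\<close>
  define h where "h u \<tau> = wexp ?S p0 n2 (\<lambda>y. \<Prod>j\<in>S. of_bool (map (collapse q j) (sub \<tau> u) @ y \<in> A))" for u \<tau>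
  have "a/4 \<le> (\<Sum>u\<in>U. h u \<tau>)" if \<tau>: "\<tau> \<in> wordset ?L n1" for \<tau>
  proof -
    have sub_\<tau>: "sub \<tau> v \<in> wordset S n1" if "v \<in> wordset S m" for v
      using \<tau> that unfolding sub_def by (intro map_in_wordset[OF \<tau>] letter_in)
    define F where "F y = wexp S pk m (\<lambda>v. of_bool (sub \<tau> v @ y \<in> A))" for y
    have "a/4 + a/4 \<le> wexp S pk m (\<lambda>v. D (sub \<tau> v))"
      using D_lo sub_\<tau> wordset_mono[of S ?S n1] \<open>\<epsilon> \<le> a / 2\<close>
      by (intro wexp_ge_const[OF wk] order_trans[OF _ D_lo]) auto
    also have "\<dots> = wexp ?S p0 n2 F"
      by (simp add: D_def F_def[abs_def] wexp_swap[of S])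
    finally have "a/4 \<le> wexp ?S p0 n2 (\<lambda>y. of_bool (a/4 \<le> F y))"
    proof (intro wexp_markov[OF w0])
      show "F y \<le> 1" for y
        unfolding F_def by (intro wexp_le_const[OF wk]) simp
    qed (use \<open>0 < a\<close> in simp_all)
    also have "\<dots> \<le> wexp ?S p0 n2 (\<lambda>y. \<Sum>u\<in>U. \<Prod>j\<in>S. of_bool (map (collapse q j) (sub \<tau> u) @ y \<in> A))"
    proof (rule wexp_mono[OF w0])
      fix y
      show "of_bool (a/4 \<le> F y) \<le> (\<Sum>u\<in>U. \<Prod>j\<in>S. (of_bool (map (collapse q j) (sub \<tau> u) @ y \<in> A) :: real))"
      proof (cases "a/4 \<le> F y")
        case True
        then have "has_subspace S 1 m {v. sub \<tau> v @ y \<in> A}"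
          by (intro m) (simp add: F_def)
        then obtain T where T: "T \<in> template S 1 m" "\<forall>v\<in>wordset S 1. sub \<tau> (sub T v) @ y \<in> A"
          by (auto simp: has_subspace_def)
        define u where "u = sub T [q]"
        have u_collapse: "map (collapse q j) u = sub T [j]" for j
          using map_collapse_sub[OF T(1) q, of "[q]" j] by (simp add: u_def collapse_def)
        have "T \<in> template ?S 1 m" using T(1) template_mono[of S ?S 1 m] by blast
        then have "u \<in> wordset ?S m"
          unfolding u_def by (rule sub_in_wordset) (simp add: wordset_def)
        moreover have "q \<in> set u"
          using T(1) by (force simp: u_def sub_def template_iff image_iff)
        ultimately have "u \<in> U" by (simp add: U_def)
        have "map (collapse q j) (sub \<tau> u) @ y \<in> A" if "j \<in> S" for j
        proof -
          have "collapse q j (letter u s) = letter (map (collapse q j) u) s" if "s \<in> set \<tau>" for s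
            using that \<tau> q \<open>u \<in> wordset ?S m\<close> by (cases s) (auto simp: wordset_def collapse_def)
          then have "map (collapse q j) (sub \<tau> u) = sub \<tau> (sub T [j])"
            by (simp add: sub_def[of \<tau>] flip: u_collapse)
          then show ?thesis using T(2) \<open>j \<in> S\<close> by (simp add: wordset_def)
        qed
        then have "1 \<le> (\<Prod>j\<in>S. (of_bool (map (collapse q j) (sub \<tau> u) @ y \<in> A) :: real))"
          by simp
        also have "\<dots> \<le> (\<Sum>u\<in>U. \<Prod>j\<in>S. of_bool (map (collapse q j) (sub \<tau> u) @ y \<in> A))"
          using \<open>u \<in> U\<close> finU by (intro member_le_sum) (auto intro: prod_nonneg)
        finally show ?thesis using True by simp
      qed (simp add: sum_nonneg prod_nonneg)
    qed
    finally show ?thesis by (simp add: wexp_sum h_def)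
  qed
  then obtain u where u: "u \<in> U" and hu: "a/4 / card U \<le> wexp ?L \<rho> n1 (h u)"
    using wexp_pigeonhole[OF w\<rho> finU, of "a/4" n1 "\<lambda>_. a/4" h] \<open>0 < a\<close> wexp_const[OF w\<rho>] by auto
  let ?C = "\<lambda>y. wexp ?S (\<nu> u) n1 (\<lambda>t. \<Prod>j\<in>S. of_bool (map (collapse q j) t @ y \<in> A))"
  have "card U > 0" using u finU by (auto simp: card_gt_0_iff)
  then have "\<theta> \<le> a/4 / card U"
    using \<open>0 < a\<close> unfolding \<theta>_def by (intro divide_left_mono) auto
  also have "\<dots> \<le> wexp ?S p0 n2 ?C"
    using hu \<nu>[OF u, of n1 "\<lambda>t. wexp ?S p0 n2 (\<lambda>y. \<Prod>j\<in>S. of_bool (map (collapse q j) t @ y \<in> A))"]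
    by (simp add: h_def[abs_def] wexp_swap[of ?S "\<nu> u"])
  finally have \<theta>: "\<theta> \<le> wexp ?S p0 n2 ?C" .
  \<comment> \<open>Exchanging the averages over \<open>t\<close> and \<open>y\<close> gives
    line-free sections at fixed \<open>y\<close>, to which \<open>good u n1\<close> applies.\<close>
  have "a - \<epsilon> \<le> wexp ?S (\<nu> u) n1 D"
    using D_lo by (intro wexp_ge_const[OF w\<nu>[OF u]])
  also have "\<dots> = wexp ?S p0 n2 (\<lambda>y. wexp ?S (\<nu> u) n1 (\<lambda>t. of_bool (t @ y \<in> A)))"
    unfolding D_def[abs_def] by (rule wexp_swap)
  also have "\<dots> \<le> wexp ?S p0 n2 (\<lambda>y. 2 * \<epsilon> + (a + \<epsilon>) * (1 - ?C y))"
  proof (rule wexp_mono[OF w0])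
    fix y assume y: "y \<in> wordset ?S n2"
    show "wexp ?S (\<nu> u) n1 (\<lambda>t. of_bool (t @ y \<in> A)) \<le> 2 * \<epsilon> + (a + \<epsilon>) * (1 - ?C y)"
      using n1[OF u, unfolded good_def, rule_format, of "{t. t @ y \<in> A}"]
        has_subspace_section_right[OF y] A(1) by auto
  qed
  also have "\<dots> = 2 * \<epsilon> + (a + \<epsilon>) * (1 - wexp ?S p0 n2 ?C)"
    by (simp add: wexp_add wexp_cmult wexp_diff wexp_const[OF w0])
  also have "\<dots> \<le> 2 * \<epsilon> + (a + \<epsilon>) * (1 - \<theta>)"
    using \<theta> \<open>0 < a\<close> \<open>0 < \<epsilon>\<close> by simp
  finally have "a * \<theta> + \<epsilon> * \<theta> \<le> 4 * \<epsilon>"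
    by (simp add: algebra_simps)
  moreover have "0 < \<epsilon> * \<theta>" using \<open>0 < \<epsilon>\<close> \<open>0 < \<theta>\<close> by simp
  ultimately show False
    using \<open>5 * \<epsilon> \<le> a * \<theta>\<close> \<open>0 < \<epsilon>\<close> by linarith
qed

section \<open>Induction on the alphabet\<close>

text \<open>\<open>Inf B\<close> is the limiting maximal density for the uniform law.
  \<open>no_extremal_density\<close> excludes a positive value, and
  \<open>line_free_density_transfer\<close> carries arbitrarily small bounds over to all
  weights.\<close>

lemma dense_lines_insert:
  assumes "finite S" "S \<noteq> {}" "q \<notin> S" "dense_subspaces S 1"
  shows "dense_subspaces (insert q S) 1"
proof -
  let ?S = "insert q S"
  define p0 where "p0 c = 1 / card ?S" for c :: 'a
  have w0: "weights ?S p0"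
    using \<open>finite S\<close> by (auto simp: weights_def p0_def simp del: card_insert_disjoint intro!: card_gt_0_iff[THEN iffD2])
  define B where "B = {b. 0 \<le> b \<and> (\<exists>n. \<forall>A. \<not> has_subspace ?S 1 n A \<longrightarrow>
      wexp ?S p0 n (\<lambda>w. of_bool (w \<in> A)) \<le> b)}"
  have "1 \<in> B" by (auto simp: B_def intro!: wexp_le_const[OF w0])
  have bdd: "bdd_below B" by (auto simp: B_def)
  have "Inf B \<le> 0"
  proof (rule ccontr)
    assume "\<not> Inf B \<le> 0"
    show False
    proof (rule no_extremal_density[OF dense_subspaces_of_lines[OF assms(4)] assms(3,2) w0, of "Inf B"])
      show "0 < Inf B" using \<open>\<not> Inf B \<le> 0\<close> by simp
      show "\<exists>n. \<forall>A. \<not> has_subspace ?S 1 n A \<longrightarrow> wexp ?S p0 n (\<lambda>w. of_bool (w \<in> A)) \<le> b"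
        if b: "Inf B < b" for b
      proof -
        obtain b' where "b' \<in> B" "b' < b"
          using cInf_lessD[OF _ b] \<open>1 \<in> B\<close> by blast
        then show ?thesis unfolding B_def by (blast intro: order_trans less_imp_le)
      qed
      show "\<exists>A. \<not> has_subspace ?S 1 n A \<and> b < wexp ?S p0 n (\<lambda>w. of_bool (w \<in> A))"
        if "b < Inf B" for b n
      proof (rule ccontr)
        assume "\<not> ?thesis"
        \<comment> \<open>Members of \<open>B\<close> are nonnegative, whereas \<open>b\<close> may
          be negative.\<close>
        then have "max b 0 \<in> B"
          by (force simp: B_def not_less)
        then have "Inf B \<le> max b 0" using bdd by (rule cInf_lower)
        then show False using that \<open>\<not> Inf B \<le> 0\<close> by simp
      qed
    qed
  qed
  show ?thesis unfolding dense_subspaces_def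
  proof (intro allI impI)
    fix p :: "'a \<Rightarrow> real" and \<delta> :: real
    assume w: "weights ?S p" and "0 < \<delta>"
    then have "Inf B < \<delta>/3" using \<open>Inf B \<le> 0\<close> by simp
    then obtain b where "b \<in> B" "b < \<delta>/3"
      using cInf_lessD[of B] \<open>1 \<in> B\<close> by blast
    then obtain n where b: "0 \<le> b" "\<And>A. \<not> has_subspace ?S 1 n A \<Longrightarrow>
        wexp ?S p0 n (\<lambda>w. of_bool (w \<in> A)) \<le> b"
      by (auto simp: B_def)
    obtain d where d: "\<And>A. \<not> has_subspace ?S 1 d A \<Longrightarrow> wexp ?S p d (\<lambda>w. of_bool (w \<in> A)) \<le> b + \<delta>/3"
      using line_free_density_transfer[OF w w0 b(1) _ b(2), of "\<delta>/3"] \<open>0 < \<delta>\<close> by auto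
    have "has_subspace ?S 1 d A" if "\<delta> \<le> wexp ?S p d (\<lambda>w. of_bool (w \<in> A))" for A
      using d[of A] that \<open>b < \<delta>/3\<close> \<open>0 < \<delta>\<close> by fastforce
    then show "\<exists>n. \<forall>A. \<delta> \<le> wexp ?S p n (\<lambda>w. of_bool (w \<in> A)) \<longrightarrow> has_subspace ?S 1 n A"
      by blast
  qed
qed

theorem density_Hales_Jewett:
  assumes "finite S" "S \<noteq> {}"
  shows "dense_subspaces S 1"
  using assms
proof (induction S rule: finite_ne_induct)
  case (singleton c)
  have "has_subspace {c} 1 1 A"
    if "0 < \<delta>" "\<delta> \<le> wexp {c} p 1 (\<lambda>w. of_bool (w \<in> A))" for p \<delta> and A
  proof -
    have "[c] \<in> A" using that by (cases "[c] \<in> A") auto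
    then have "sub [Inr 0] v \<in> A" if "v \<in> wordset {c} 1" for v
      using that by (auto simp: wordset_def sub_def length_Suc_conv)
    then show ?thesis
      by (auto simp: has_subspace_def template_iff intro!: bexI[of _ "[Inr 0]"])
  qed
  then show ?case unfolding dense_subspaces_def by blast
next
  case (insert q S)
  then show ?case by (intro dense_lines_insert)
qed

section \<open>Strongly stationary laws\<close>

text \<open>For \<open>i \<ge> 1\<close> the set \<open>I i\<close> lies above
  \<open>N (i - 1)\<close> and up to \<open>N i\<close>; these sets are disjoint, so
  \<open>THE\<close> selects a unique index.\<close>

lemma sub_word_in_allwords:
  assumes inf: "inf_subspace k N I W" and u: "u \<in> allwords k"
  shows "sub_word N I (W (length u)) u \<in> allwords k"
proof -
  have N: "strict_mono N"
    and I: "\<And>i. I (Suc i) \<subseteq> {N i<..N (Suc i)}" and W: "\<And>n. W n \<in> words k (N n)"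
    using inf by (auto simp: inf_subspace_def)
  have uk: "set u \<subseteq> {1..k}" "0 < length u" using u by (auto simp: allwords_def)
  have disj: "i = i'" if "m \<in> I i" "m \<in> I i'" "1 \<le> i" "1 \<le> i'" for m i i'
  proof -
    have less: False if "m \<in> I i" "m \<in> I i'" "1 \<le> i" "i < i'" for i i'
    proof -
      have "m \<le> N i" "N (i' - 1) < m"
        using that I[of "i - 1"] I[of "i' - 1"] by auto
      moreover have "N i \<le> N (i' - 1)"
        using that strict_mono_less_eq[OF N] by simp
      ultimately show False by simp
    qed
    then show ?thesis
      using that by (metis linorder_neqE_nat)
  qed
  have letters: "(if \<exists>i\<in>{1..length u}. m \<in> I i
         then u ! ((THE i. i \<in> {1..length u} \<and> m \<in> I i) - 1)
         else W (length u) ! (m - 1)) \<in> {1..k}"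
    if m: "m \<in> set [1..<N (length u) + 1]" for m
  proof (cases "\<exists>i\<in>{1..length u}. m \<in> I i")
    case True
    then obtain i where i: "i \<in> {1..length u}" "m \<in> I i" by blast
    then have "(THE i. i \<in> {1..length u} \<and> m \<in> I i) = i"
      using disj by (intro the_equality) auto
    then have "u ! ((THE i. i \<in> {1..length u} \<and> m \<in> I i) - 1) \<in> set u"
      using i by (intro nth_mem) auto
    then show ?thesis
      using uk True by auto
  next
    case False
    have "m - 1 < length (W (length u))"
      using W[of "length u"] m by (auto simp: words_def)
    then have "W (length u) ! (m - 1) \<in> set (W (length u))" by simp
    then show ?thesis
      using False W[of "length u"] by (auto simp: words_def)
  qed
  have "set (sub_word N I (W (length u)) u) \<subseteq> {1..k}"
    unfolding sub_word_def set_map by (rule image_subsetI) (rule letters)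
  moreover have "0 < N (length u)"
    using strict_monoD[OF N uk(2)] by simp
  then have "sub_word N I (W (length u)) u \<noteq> []"
    by (simp add: sub_word_def)
  ultimately show ?thesis
    by (simp add: allwords_def)
qed

text \<open>Strong stationarity speaks of infinite-dimensional subspaces. The line is continued by
  one-position wildcard sets, which words of length 1 do not reach.\<close>

lemma line_extends_to_inf_subspace:
  assumes fin: "finite_subspace k 1 N I w" and "1 \<le> k"
  obtains N' I' W where "inf_subspace k N' I' W"
    "\<And>j. sub_word N' I' (W 1) [j] = sub_word N I w [j]"
proof -
  have N: "N 0 = 0" "0 < N 1" and I: "I 1 \<noteq> {}" "I 1 \<subseteq> {0<..N 1}" and w: "w \<in> words k (N 1)"
    using fin by (auto simp: finite_subspace_def)
  define N' where "N' i = (if i = 0 then 0 else N 1 + (i - 1))" for i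
  define I' where "I' i = (if i = 1 then I 1 else {N' i})" for i
  define W where "W n = (if n = 1 then w else replicate (N' n) 1)" for n
  have "strict_mono N'"
    using N by (auto simp: strict_mono_Suc_iff N'_def)
  moreover have "I' (Suc i) \<noteq> {} \<and> I' (Suc i) \<subseteq> {N' i<..N' (Suc i)}" for i
    using I N by (cases i) (auto simp: I'_def N'_def)
  moreover have "W n \<in> words k (N' n)" for n
    using w \<open>1 \<le> k\<close> by (auto simp: W_def words_def N'_def)
  ultimately have "inf_subspace k N' I' W"
    by (auto simp: inf_subspace_def N'_def)
  moreover have "sub_word N' I' (W 1) [j] = sub_word N I w [j]" for j
  proof -
    have "(THE i. i = Suc 0 \<and> m \<in> J i) = Suc 0" if "m \<in> J (Suc 0)" for m and J :: "nat \<Rightarrow> nat set"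
      using that by (intro the_equality) auto
    then show ?thesis
      by (simp add: sub_word_def N'_def I'_def W_def)
  qed
  ultimately show ?thesis by (rule that)
qed

text \<open>With a single wildcard there is nothing to order, so templates of dimension 1 are lines
  in the sense of \<open>finite_subspace\<close>.\<close>

lemma line_template_as_sub_word:
  assumes T: "T \<in> template {1..k} 1 n" and "1 \<le> k"
  obtains N I w where "finite_subspace k 1 N I w" "\<And>j. sub_word N I w [j] = sub T [j]"
proof -
  have T: "length T = n" "set T \<subseteq> {1..k} <+> {..<1}" "Inr 0 \<in> set T"
    using T by (simp_all add: template_iff)
  define N where "N i = (if i = 0 then 0 else n)" for i :: nat
  define I where "I i = {m \<in> {1..n}. T ! (m - 1) = Inr 0}" for i :: nat
  have letters: "letter [1] s \<in> {1..k}" if "s \<in> set T" for s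
    using subsetD[OF T(2) that] \<open>1 \<le> k\<close> by (intro letter_in[of s _ 1]) (auto simp: wordset_def)
  obtain i where i: "i < n" "T ! i = Inr 0"
    using T(1,3) by (auto simp: in_set_conv_nth)
  then have "Suc i \<in> I 1" by (simp add: I_def)
  then have "I 1 \<noteq> {}" by blast
  moreover have "I 1 \<subseteq> {0<..n}" by (auto simp: I_def)
  \<comment> \<open>The letter 1 fills the wildcard positions, where \<open>sub_word\<close> reads
    its argument instead.\<close>
  moreover have "sub T [1] \<in> words k n"
    using T(1) letters by (auto simp: words_def sub_def)
  ultimately have "finite_subspace k 1 N I (sub T [1])"
    using i by (simp add: finite_subspace_def N_def)
  moreover have "sub_word N I (sub T [1]) [j] = sub T [j]" for j
  proof (rule nth_equalityI)
    show "length (sub_word N I (sub T [1]) [j]) = length (sub T [j])"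
      using T(1) by (simp add: sub_word_def sub_def N_def)
    fix m assume "m < length (sub_word N I (sub T [1]) [j])"
    then have m: "m < n" by (simp add: sub_word_def N_def del: upt_Suc)
    then have nth: "sub_word N I (sub T [1]) [j] ! m = (if Suc m \<in> I 1
       then [j] ! ((THE i. i = 1 \<and> Suc m \<in> I i) - 1) else sub T [1] ! m)"
      by (simp add: sub_word_def N_def del: upt_Suc)
    show "sub_word N I (sub T [1]) [j] ! m = sub T [j] ! m"
    proof (cases "T ! m = Inr 0")
      case True
      then have "Suc m \<in> I i" for i using m by (simp add: I_def)
      then show ?thesis using nth True m T(1) by (simp add: sub_def)
    next
      case False
      moreover have "T ! m \<in> {1..k} <+> {..<1}"
        using T(1,2) m nth_mem by blast
      ultimately obtain c where "T ! m = Inl c" by auto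
      then show ?thesis using nth m T(1) by (simp add: sub_def I_def)
    qed
  qed
  ultimately show ?thesis by (rule that)
qed

section \<open>Laws of lines and points\<close>

lemma space_config: "sets \<mu> = sets (config_space k) \<Longrightarrow> space \<mu> = PiE (allwords k) (\<lambda>_. UNIV)"
  by (drule sets_eq_imp_space_eq) (simp add: config_space_def space_PiM)

lemma measurable_coordinate:
  assumes "sets \<mu> = sets (config_space k)" "u \<in> allwords k"
  shows "(\<lambda>x. x u) \<in> measurable \<mu> borel"
proof -
  have "(\<lambda>x. x u) \<in> measurable (config_space k) borel"
    unfolding config_space_def using assms(2) by measurable
  then show ?thesis
    using assms(1) by (simp cong: measurable_cong_sets)
qed

lemma coordinates_in_sets:
  assumes "sets \<mu> = sets (config_space k)" and "finite J"
    and "\<And>j. j \<in> J \<Longrightarrow> f j \<in> allwords k" "\<And>j. j \<in> J \<Longrightarrow> A j \<in> sets borel"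
  shows "{x \<in> space \<mu>. \<forall>j\<in>J. x (f j) \<in> A j} \<in> sets \<mu>"
  using assms by (intro sets.sets_Collect_finite_All measurable_sets_Collect[OF measurable_coordinate]) auto

lemma singleton_in_allwords: "j \<in> {1..k} \<Longrightarrow> [j] \<in> allwords k"
  by (simp add: allwords_def)

text \<open>The infinite-dimensional subspace extending the line maps \<open>[j]\<close> to its
  point at \<open>j\<close>, so invariance compares every line with that of the one-letter
  words.\<close>

lemma stationary_line:
  assumes "1 \<le> k" and sets: "sets \<mu> = sets (config_space k)" and st: "strongly_stationary k \<mu>"
    and fin: "finite_subspace k 1 N I w"
  shows "j \<in> {1..k} \<Longrightarrow> sub_word N I w [j] \<in> allwords k"
    and "(\<And>j. j \<in> {1..k} \<Longrightarrow> A j \<in> sets borel) \<Longrightarrow>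
      measure \<mu> {x \<in> space \<mu>. \<forall>j\<in>{1..k}. x (sub_word N I w [j]) \<in> A j}
      = measure \<mu> {x \<in> space \<mu>. \<forall>j\<in>{1..k}. x [j] \<in> A j}"
proof -
  obtain N' I' W where inf: "inf_subspace k N' I' W"
    and eq: "\<And>j. sub_word N' I' (W 1) [j] = sub_word N I w [j]"
    using line_extends_to_inf_subspace[OF fin \<open>1 \<le> k\<close>] by metis
  show in_allwords: "sub_word N I w [j] \<in> allwords k" if "j \<in> {1..k}" for j
    using sub_word_in_allwords[OF inf singleton_in_allwords[OF that]] eq by simp
  assume A: "\<And>j. j \<in> {1..k} \<Longrightarrow> A j \<in> sets borel"
  define \<Phi> where "\<Phi> x = (\<lambda>u\<in>allwords k. x (sub_word N' I' (W (length u)) u))" for x :: "nat list \<Rightarrow> 'a"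
  let ?E = "{x \<in> space \<mu>. \<forall>j\<in>{1..k}. x [j] \<in> A j}"
  have "\<Phi> \<in> measurable \<mu> (config_space k)"
    unfolding \<Phi>_def config_space_def
    by (intro measurable_restrict measurable_coordinate[OF sets] sub_word_in_allwords[OF inf])
  moreover have "?E \<in> sets (config_space k)"
    unfolding sets[symmetric] using A singleton_in_allwords by (intro coordinates_in_sets[OF sets]) auto
  ultimately have "measure (distr \<mu> (config_space k) \<Phi>) ?E = measure \<mu> (\<Phi> -` ?E \<inter> space \<mu>)"
    by (rule measure_distr)
  moreover have "distr \<mu> (config_space k) \<Phi> = \<mu>"
    using st inf unfolding strongly_stationary_def \<Phi>_def[abs_def] by blast
  moreover have "\<Phi> -` ?E \<inter> space \<mu> = {x \<in> space \<mu>. \<forall>j\<in>{1..k}. x (sub_word N I w [j]) \<in> A j}"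
    using singleton_in_allwords eq by (auto simp: \<Phi>_def space_config[OF sets])
  ultimately show "measure \<mu> {x \<in> space \<mu>. \<forall>j\<in>{1..k}. x (sub_word N I w [j]) \<in> A j} = measure \<mu> ?E"
    by simp
qed

lemma stationary_template:
  assumes "1 \<le> k" and sets: "sets \<mu> = sets (config_space k)" and st: "strongly_stationary k \<mu>"
    and T: "T \<in> template {1..k} 1 n" and A: "\<And>j. j \<in> {1..k} \<Longrightarrow> A j \<in> sets borel"
  shows "measure \<mu> {x \<in> space \<mu>. \<forall>j\<in>{1..k}. x (sub T [j]) \<in> A j}
      = measure \<mu> {x \<in> space \<mu>. \<forall>j\<in>{1..k}. x [j] \<in> A j}"
proof -
  obtain N I w where fin: "finite_subspace k 1 N I w" and eq: "\<And>j. sub_word N I w [j] = sub T [j]"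
    using line_template_as_sub_word[OF T \<open>1 \<le> k\<close>] by metis
  show ?thesis
    using stationary_line(2)[OF assms(1-3) fin A] by (simp add: eq)
qed

text \<open>A word containing \<open>c\<close> is the point at \<open>c\<close> of the line that
  frees all its letters \<open>c\<close>, so it has the law of \<open>[c]\<close>. Different letters
  are compared through a two-letter word containing both.\<close>

lemma stationary_point:
  assumes "1 \<le> k" and sets: "sets \<mu> = sets (config_space k)" and st: "strongly_stationary k \<mu>"
    and u: "u \<in> allwords k" and v: "v \<in> allwords k" and B: "B \<in> sets borel"
  shows "measure \<mu> {x \<in> space \<mu>. x u \<in> B} = measure \<mu> {x \<in> space \<mu>. x v \<in> B}"
proof -
  have letter: "measure \<mu> {x \<in> space \<mu>. x v \<in> B} = measure \<mu> {x \<in> space \<mu>. x [c] \<in> B}"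
    if v: "v \<in> allwords k" and c: "c \<in> set v" for v c
  proof -
    let ?T = "map (\<lambda>d. if d = c then Inr (0::nat) else Inl d) v"
    have ck: "c \<in> {1..k}" "set v \<subseteq> {1..k}" using v c by (auto simp: allwords_def)
    have "Inr 0 \<in> set ?T"
      unfolding set_map using c by (intro image_eqI[of _ _ c]) simp_all
    moreover have "set ?T \<subseteq> {1..k} <+> {..<1}"
      using ck by auto
    ultimately have T: "?T \<in> template {1..k} 1 (length v)"
      by (simp add: template_iff)
    have sub: "sub ?T [c] = v"
      by (simp add: sub_def comp_def map_idI)
    have "{x \<in> space \<mu>. \<forall>j\<in>{1..k}. x (f j) \<in> (if j = c then B else UNIV)} = {x \<in> space \<mu>. x (f c) \<in> B}" for f
      using ck by auto
    moreover have "(if j = c then B else UNIV) \<in> sets borel" for j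
      using B by simp
    ultimately show ?thesis
      using stationary_template[OF assms(1-3) T, of "\<lambda>j. if j = c then B else UNIV"]
      by (simp only: sub)
  qed
  have hd: "hd u \<in> set u" "hd v \<in> set v" using u v by (auto simp: allwords_def)
  then have "hd u \<in> {1..k}" "hd v \<in> {1..k}"
    using u v unfolding allwords_def by blast+
  then have "[hd u, hd v] \<in> allwords k" by (simp add: allwords_def)
  then show ?thesis
    using letter[OF u hd(1)] letter[OF v hd(2)] letter[of "[hd u, hd v]" "hd u"] letter[of "[hd u, hd v]" "hd v"]
    by simp
qed

theorem theorem5p3:
  fixes k :: nat and \<mu> :: "(nat list \<Rightarrow> 'a::polish_space) measure"
    and A :: "nat \<Rightarrow> 'a set"
    and N :: "nat \<Rightarrow> nat" and I :: "nat \<Rightarrow> nat set" and w :: "nat list" and u :: "nat list"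
  assumes "k \<ge> 1"
    and "prob_space \<mu>"
    and "sets \<mu> = sets (config_space k)"
    and "strongly_stationary k \<mu>"
    and "\<forall>j\<in>{1..k}. A j \<in> sets borel"
    and "finite_subspace k 1 N I w"
    and "u \<in> allwords k"
  shows "measure (mu_line k \<mu> N I w) (PiE {1..k} A) = 0
         \<Longrightarrow> measure (mu_pt \<mu> u) (\<Inter>j\<in>{1..k}. A j) = 0"
proof -
  assume line0: "measure (mu_line k \<mu> N I w) (PiE {1..k} A) = 0"
  interpret prob_space \<mu> by fact
  note sets = assms(3) and st = assms(1,3,4)
  let ?S = "{1..k}"
  define B where "B = (\<Inter>j\<in>?S. A j)"
  have B: "B \<in> sets borel"
    unfolding B_def using assms(1,5) by (intro sets.finite_INT) auto
  have A: "A j \<in> sets borel" if "j \<in> ?S" for j using assms(5) that by blast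
  have allwords: "v \<in> allwords k" if "v \<in> wordset ?S n" "0 < n" for v n
    using that by (auto simp: wordset_def allwords_def)
  let ?\<Phi> = "\<lambda>x. \<lambda>j\<in>?S. x (sub_word N I w [j])"
  have "measure (mu_line k \<mu> N I w) (PiE ?S A) = prob (?\<Phi> -` PiE ?S A \<inter> space \<mu>)"
    unfolding mu_line_def
    by (intro measure_distr measurable_restrict measurable_coordinate[OF sets]
        stationary_line(1)[OF st assms(6)] sets_PiM_I_finite A) auto
  also have "?\<Phi> -` PiE ?S A \<inter> space \<mu> = {x \<in> space \<mu>. \<forall>j\<in>?S. x (sub_word N I w [j]) \<in> A j}"
    by (auto simp: PiE_iff)
  also have "prob \<dots> = prob {x \<in> space \<mu>. \<forall>j\<in>?S. x [j] \<in> A j}"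
    by (rule stationary_line(2)[OF st assms(6) A])
  finally have null: "prob {x \<in> space \<mu>. \<forall>j\<in>?S. x [j] \<in> A j} = 0"
    using line0 by simp
  define \<delta> where "\<delta> = prob {x \<in> space \<mu>. x u \<in> B}"
  have "\<delta> \<le> 0"
  proof (rule ccontr)
    assume "\<not> \<delta> \<le> 0"
    then have "0 < \<delta>" by simp
    define p where "p c = 1 / k" for c :: nat
    have wp: "weights ?S p"
      using assms(1) by (auto simp: weights_def p_def)
    have "dense_subspaces ?S 1"
      using assms(1) by (intro density_Hales_Jewett) auto
    then obtain n where n: "\<And>F. \<delta>/2 \<le> wexp ?S p n (\<lambda>w. of_bool (w \<in> F)) \<Longrightarrow> has_subspace ?S 1 n F"
      using wp half_gt_zero[OF \<open>0 < \<delta>\<close>] unfolding dense_subspaces_def by blast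
    have "\<delta> \<le> 1" by (simp add: \<delta>_def)
    \<comment> \<open>Applied to all words, the choice of \<open>n\<close> yields a line of length
      \<open>n\<close>, hence \<open>0 < n\<close>; this matters because \<open>allwords\<close>
      omits the empty word.\<close>
    then have "\<delta>/2 \<le> wexp ?S p n (\<lambda>w. of_bool (w \<in> UNIV))"
      using \<open>0 < \<delta>\<close> by (simp only: UNIV_I of_bool_eq wexp_const[OF wp])
    then have "has_subspace ?S 1 n UNIV" by (rule n)
    then have "0 < n"
      by (auto simp: has_subspace_def template_iff)
    \<comment> \<open>The density of the random set of words with coordinate in \<open>B\<close>; by
      \<open>stationary_point\<close> its mean is \<open>\<delta>\<close>.\<close>
    define f where "f x = wexp ?S p n (\<lambda>w. of_bool (x w \<in> B))" for x
    have f: "f x = (\<Sum>w\<in>wordset ?S n. prod_list (map p w) * indicator {x \<in> space \<mu>. x w \<in> B} x)"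
      if "x \<in> space \<mu>" for x
      using that by (simp add: f_def wexp_eq_sum indicator_def of_bool_def)
    have meas: "{x \<in> space \<mu>. x v \<in> B} \<in> sets \<mu>" if "v \<in> wordset ?S n" for v
      using coordinates_in_sets[OF sets, of "{()}" "\<lambda>_. v" "\<lambda>_. B"] allwords[OF that \<open>0 < n\<close>] B by simp
    have int: "integrable \<mu> (\<lambda>x. prod_list (map p v) * indicator {x \<in> space \<mu>. x v \<in> B} x :: real)"
      if "v \<in> wordset ?S n" for v
      using meas[OF that] by (intro integrable_mult_right) (auto simp: emeasure_eq_measure)
    have "integrable \<mu> f \<longleftrightarrow> integrable \<mu> (\<lambda>x. \<Sum>v\<in>wordset ?S n. prod_list (map p v) * indicator {x \<in> space \<mu>. x v \<in> B} x :: real)"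
      by (intro Bochner_Integration.integrable_cong) (simp_all add: f)
    then have int_f: "integrable \<mu> f"
      using int by (simp add: Bochner_Integration.integrable_sum)
    have "expectation f = expectation (\<lambda>x. \<Sum>v\<in>wordset ?S n. prod_list (map p v) * indicator {x \<in> space \<mu>. x v \<in> B} x)"
      by (intro Bochner_Integration.integral_cong) (simp_all add: f)
    also have "\<dots> = (\<Sum>v\<in>wordset ?S n. prod_list (map p v) * prob {x \<in> space \<mu>. x v \<in> B})"
      using int meas by (subst Bochner_Integration.integral_sum) (auto intro!: sum.cong)
    also have "\<dots> = wexp ?S p n (\<lambda>v. prob {x \<in> space \<mu>. x v \<in> B})"
      by (simp add: wexp_eq_sum)
    also have "\<dots> = wexp ?S p n (\<lambda>v. \<delta>)"
      unfolding \<delta>_def using allwords \<open>0 < n\<close> assms(7) B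
      by (intro wexp_cong stationary_point[OF st]) auto
    finally have "expectation f = \<delta>"
      by (simp only: wexp_const[OF wp])
    \<comment> \<open>Each of the finitely many lines of length \<open>n\<close> has the law of the
      line of letters, so almost surely none lies in \<open>B\<close>. By the choice of
      \<open>n\<close>, the density is then below \<open>\<delta>/2\<close>, against the mean
      \<open>\<delta>\<close>.\<close>
    moreover have "AE x in \<mu>. f x \<le> \<delta>/2"
    proof -
      have "AE x in \<mu>. \<not> (\<forall>j\<in>?S. x (sub T [j]) \<in> A j)" if T: "T \<in> template ?S 1 n" for T
      proof -
        let ?E = "{x \<in> space \<mu>. \<forall>j\<in>?S. x (sub T [j]) \<in> A j}"
        have "?E \<in> events"
          using A allwords[OF sub_in_wordset[OF T] \<open>0 < n\<close>]
          by (intro coordinates_in_sets[OF sets]) (auto simp: wordset_def)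
        moreover have "prob ?E = 0"
          using stationary_template[OF st T A] null by simp
        ultimately have "AE x in \<mu>. x \<notin> ?E"
          by (simp add: prob_eq_0)
        then show ?thesis by (rule AE_mp) (auto intro!: AE_I2)
      qed
      then have "AE x in \<mu>. \<forall>T\<in>template ?S 1 n. \<not> (\<forall>j\<in>?S. x (sub T [j]) \<in> A j)"
        by (intro AE_finite_allI finite_template) auto
      then show ?thesis
      proof (rule AE_mp, intro AE_I2 impI)
        fix x assume no_line: "\<forall>T\<in>template ?S 1 n. \<not> (\<forall>j\<in>?S. x (sub T [j]) \<in> A j)"
        have "\<not> has_subspace ?S 1 n {w. x w \<in> B}"
        proof
          assume "has_subspace ?S 1 n {w. x w \<in> B}"
          then obtain T where "T \<in> template ?S 1 n" and T: "\<forall>v\<in>wordset ?S 1. x (sub T v) \<in> B"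
            by (auto simp: has_subspace_def)
          moreover have "x (sub T [j]) \<in> A j" if j: "j \<in> ?S" for j
          proof -
            have "x (sub T [j]) \<in> B" using T j by (simp add: wordset_def)
            then show ?thesis using j by (simp add: B_def)
          qed
          ultimately show False using no_line by blast
        qed
        then show "f x \<le> \<delta>/2"
          using n[of "{w. x w \<in> B}"] by (fastforce simp: f_def)
      qed
    qed
    then have "expectation f \<le> expectation (\<lambda>_. \<delta>/2)"
      using int_f by (intro integral_mono_AE) auto
    ultimately show False
      using \<open>0 < \<delta>\<close> by (simp add: prob_space)
  qed
  then have "\<delta> = 0"
    using measure_nonneg[of \<mu>] by (simp add: \<delta>_def order_antisym)
  moreover have "measure (mu_pt \<mu> u) B = prob ((\<lambda>x. x u) -` B \<inter> space \<mu>)"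
    unfolding mu_pt_def using measurable_coordinate[OF sets assms(7)] B by (rule measure_distr)
  moreover have "(\<lambda>x. x u) -` B \<inter> space \<mu> = {x \<in> space \<mu>. x u \<in> B}"
    by auto
  ultimately show "measure (mu_pt \<mu> u) (\<Inter>j\<in>{1..k}. A j) = 0"
    by (simp add: \<delta>_def B_def)
qed

end
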